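(* Let $r\in\{1,2\}$, let $\tau_s$ be a predetermined secrecy rate and $\Psi=2^{\tau_s}$. Let $F_{\gamma_d}$ be the cumulative distribution function of the destination SNR $\gamma_d$ and $f_{\gamma_e}$ the probability density function of the eavesdropper SNR $\gamma_e$, given by the expressions in the context. Then the lower bound of the secrecy outage probability $$\mathrm{SOP}_L=\int_0^\infty F_{\gamma_d}(\Psi\gamma)\,f_{\gamma_e}(\gamma)\,d\gamma$$ is given in closed form by $$\mathrm{SOP}_L=\frac{\Lambda_{1,e}\Lambda_{3,d}\,\mu_{r,d}^{\frac{l_e}{r}}}{r\,\mu_{r,e}^{\frac{l_e}{r}}\,\Psi^{\frac{l_e}{r}}\,\Lambda_{4,d}^{\frac{l_d+l_e}{r}}(2\pi)^{\frac{r-1}{2}}}\;G_{r+1,r+1}^{r+1,r}\left[\frac{\Lambda_{2,e}^{r}\,\mu_{r,d}}{r^{r}\,\Psi\,\Lambda_{4,d}\,\mu_{r,e}}\,\middle|\,\begin{array}{c}t_{5,1},\dots,t_{5,r+1}\\ 0,\frac{r-1}{r},\frac{-l_d}{r}\end{array}\right],$$ where, with $\varpi=1-\frac{l_d}{r}-\frac{l_e}{r}$, the upper parameters are $t_5=(\varpi,\ \varpi+l_d)$ if $r=1$ and $t_5=\left(\varpi,\ \varpi-\tfrac12,\ \varpi+\tfrac{l_d}{2}\right)$ if $r=2$.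
   Context: Meijer's G function: $G^{m,n}_{p,q}\left[z\,\middle|\,\begin{array}{c}a_1,\dots,a_p\\ b_1,\dots,b_q\end{array}\right]=\frac{1}{2\pi i}\int_{L}\frac{\prod_{i=1}^{m}\Gamma(b_i+s)\prod_{i=1}^{n}\Gamma(1-a_i-s)}{\prod_{i=n+1}^{p}\Gamma(a_i+s)\prod_{i=m+1}^{q}\Gamma(1-b_i-s)}z^{-s}\,ds$, where $L$ separates the poles of the $\Gamma(b_i+s)$ ($i\le m$) from those of the $\Gamma(1-a_i-s)$ ($i\le n$). In a parameter list, "$0,\frac{r-1}{r}$" denotes the single entry $0$ if $r=1$, and the two entries $0,\frac12$ if $r=2$. Setting. There are two links $j\in\{d,e\}$ ($d$: source–RIS–destination; $e$: source–RIS–eavesdropper; RIS = reconfigurable intelligent surface), with $N_j$ reflecting elements on link $j$. $M_j$ denotes the two-hop channel gain through one reflecting element (a product of two inverted Gamma-Gamma turbulence variables with pointing errors), a positive random variable with mean $E_j=\mathbb{E}(M_j)>0$ and variance $0<\mathrm{Var}(M_j)<\infty$; only these two numbers enter. Put $l_j=N_jE_j^2/\mathrm{Var}(M_j)$, $k_j=\mathrm{Var}(M_j)/E_j$, $\Lambda_{1,j}=\frac{E_j^{l_j}}{\Gamma(l_j)k_j^{l_j}}$, $\Lambda_{2,j}=\frac{E_j}{k_j}$, $\Lambda_{3,j}=\frac{E_j^{l_j}}{\Gamma(l_j)k_j^{l_j}(2\pi)^{(r-1)/2}}$, $\Lambda_{4,j}=\left[\frac{E_j}{k_jr}\right]^r$.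 The number $\mu_{r,j}>0$ is the electrical SNR of link $j$ and $r$ is the detection type ($r=1$ heterodyne, $r=2$ intensity modulation/direct detection). The density and distribution function of the instantaneous SNR $\gamma_j$ are $$f_{\gamma_j}(\gamma)=\frac{\Lambda_{1,j}}{r\,\mu_{r,j}^{l_j/r}}\,\gamma^{\frac{l_j}{r}-1}\,G_{0,1}^{1,0}\left[\Lambda_{2,j}\left(\frac{\gamma}{\mu_{r,j}}\right)^{\frac1r}\,\middle|\,\begin{array}{c}-\\ 0\end{array}\right],\qquad F_{\gamma_j}(\gamma)=\frac{\Lambda_{3,j}}{\sqrt r\,\mu_{r,j}^{l_j/r}}\,\gamma^{\frac{l_j}{r}}\,G_{1,r+1}^{r,1}\left[\Lambda_{4,j}\frac{\gamma}{\mu_{r,j}}\,\middle|\,\begin{array}{c}1-\frac{l_j}{r}\\ 0,\frac{r-1}{r},\frac{-l_j}{r}\end{array}\right].$$ The secrecy outage probability SOP is the probability that the instantaneous secrecy capacity falls below $\tau_s$; it satisfies $\mathrm{SOP}\ge\mathrm{SOP}_L$.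
   Formalization: The last lower parameter of the final G-function is corrected from -l_d/r to -l_e/r; as printed the formula fails, e.g. for r=1, l_d=2, l_e=1 and G-argument 1/2 it gives 4/3 while SOP_L=4/9; the two agree when l_d=l_e. *)

theory Defs
  imports "HOL-Complex_Analysis.Complex_Analysis" "HOL-Probability.Probability"
begin

section \<open>Meijer's G function\<close>

text \<open>
  An infinite contour from \<open>- \<i> \<infinity>\<close> to \<open>\<i> \<infinity>\<close> is given by a finite piece \<open>g\<close>, continued by a vertical
  half-line downwards from its start and a vertical half-line upwards from its end. The path
  \<open>truncated_contour g X\<close> is the part of it between the heights \<open>- X\<close> and \<open>X\<close>, for large \<open>X\<close>.
\<close>

definition truncated_contour :: "(real \<Rightarrow> complex) \<Rightarrow> real \<Rightarrow> real \<Rightarrow> complex" where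
  "truncated_contour g X =
     linepath (Complex (Re (pathstart g)) (- X)) (pathstart g) +++ g +++
     linepath (pathfinish g) (Complex (Re (pathfinish g)) X)"

text \<open>
  A point off the contour lies to the left of the upward contour if the contour makes a
  positive half-turn about it, and to the right if it makes a negative half-turn.
\<close>

definition contour_index :: "(real \<Rightarrow> complex) \<Rightarrow> complex \<Rightarrow> complex \<Rightarrow> bool" where
  "contour_index g p k \<longleftrightarrow>
     (\<forall>\<^sub>F X in at_top. p \<notin> path_image (truncated_contour g X)) \<and>
     ((\<lambda>X. winding_number (truncated_contour g X) p) \<longlongrightarrow> k) at_top"

definition contour_separates :: "(real \<Rightarrow> complex) \<Rightarrow> complex set \<Rightarrow> complex set \<Rightarrow> bool" where
  "contour_separates g A B \<longleftrightarrow>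
     valid_path g \<and> (\<forall>p\<in>A. contour_index g p (1/2)) \<and> (\<forall>p\<in>B. contour_index g p (- 1/2))"

text \<open>
  The lists \<open>a\<close>, \<open>b\<close> are the upper and lower parameters, so \<open>p = length a\<close>, \<open>q = length b\<close>;
  the parameter with mathematical index \<open>i\<close> is the list entry with index \<open>i - 1\<close>. \<open>Gamma\<close> is \<open>0\<close>
  at its poles and division by \<open>0\<close> gives \<open>0\<close>, so dividing by \<open>Gamma\<close> is multiplying by the
  entire function \<open>1 / Gamma\<close>.
\<close>

definition meijer_G_integrand ::
    "nat \<Rightarrow> nat \<Rightarrow> complex list \<Rightarrow> complex list \<Rightarrow> complex \<Rightarrow> complex \<Rightarrow> complex" where
  "meijer_G_integrand m n a b z s =
     (\<Prod>i<m. Gamma (b ! i + s)) * (\<Prod>i<n. Gamma (1 - a ! i - s)) /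
     ((\<Prod>i=n..<length a. Gamma (a ! i + s)) * (\<Prod>i=m..<length b. Gamma (1 - b ! i - s)))
     * z powr (- s)"

definition meijer_G_left_poles :: "nat \<Rightarrow> complex list \<Rightarrow> complex set" where
  "meijer_G_left_poles m b = {- (b ! i) - of_nat k |i k. i < m}"

definition meijer_G_right_poles :: "nat \<Rightarrow> complex list \<Rightarrow> complex set" where
  "meijer_G_right_poles n a = {1 - a ! i + of_nat k |i k. i < n}"

text \<open>
  The value is the same for all separating contours, hence the definite description. Only
  contours from \<open>- \<i> \<infinity>\<close> to \<open>\<i> \<infinity>\<close> are used: the integral along them converges in the range
  \<open>m + n > (p + q) / 2\<close>, \<open>\<bar>Arg z\<bar> < (m + n - (p + q) / 2) * pi\<close>.
\<close>

definition meijer_G ::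
    "nat \<Rightarrow> nat \<Rightarrow> complex list \<Rightarrow> complex list \<Rightarrow> complex \<Rightarrow> complex" where
  "meijer_G m n a b z =
     (THE I. \<exists>g. contour_separates g (meijer_G_left_poles m b) (meijer_G_right_poles n a) \<and>
        ((\<lambda>X. 1 / (2 * of_real pi * \<i>) *
            contour_integral (truncated_contour g X) (meijer_G_integrand m n a b z))
          \<longlongrightarrow> I) at_top)"

section \<open>Instantaneous SNR of a link\<close>

definition Lambda1 :: "real \<Rightarrow> real \<Rightarrow> real \<Rightarrow> real" where
  "Lambda1 E k l = E powr l / (Gamma l * k powr l)"

definition Lambda2 :: "real \<Rightarrow> real \<Rightarrow> real" where
  "Lambda2 E k = E / k"

definition Lambda3 :: "nat \<Rightarrow> real \<Rightarrow> real \<Rightarrow> real \<Rightarrow> real" where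
  "Lambda3 r E k l = E powr l / (Gamma l * k powr l * (2 * pi) powr ((real r - 1) / 2))"

definition Lambda4 :: "nat \<Rightarrow> real \<Rightarrow> real \<Rightarrow> real" where
  "Lambda4 r E k = (E / (k * real r)) ^ r"

text \<open>The entries abbreviated \<open>0, (r-1)/r\<close>: a single \<open>0\<close> if \<open>r = 1\<close>.\<close>

definition zero_half :: "nat \<Rightarrow> real list" where
  "zero_half r = (if r = 1 then [0] else [0, (real r - 1) / real r])"

definition snr_pdf_expr :: "nat \<Rightarrow> real \<Rightarrow> real \<Rightarrow> real \<Rightarrow> real \<Rightarrow> real \<Rightarrow> complex" where
  "snr_pdf_expr r E k l \<mu> x =
     of_real (Lambda1 E k l / (real r * \<mu> powr (l / real r)) * x powr (l / real r - 1)) *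
     meijer_G 1 0 [] [0] (of_real (Lambda2 E k * (x / \<mu>) powr (1 / real r)))"

definition snr_cdf_expr :: "nat \<Rightarrow> real \<Rightarrow> real \<Rightarrow> real \<Rightarrow> real \<Rightarrow> real \<Rightarrow> complex" where
  "snr_cdf_expr r E k l \<mu> x =
     of_real (Lambda3 r E k l / (sqrt (real r) * \<mu> powr (l / real r)) * x powr (l / real r)) *
     meijer_G r 1 [of_real (1 - l / real r)] (map of_real (zero_half r @ [- l / real r]))
       (of_real (Lambda4 r E k * (x / \<mu>)))"

text \<open>
  Misprint in the source: its closed form for the lower bound of the secrecy outage probability has
  \<open>- l_d / r\<close> as last lower parameter of the final G-function. Multiplying the Mellin-Barnes
  integrands of the destination distribution function and the eavesdropper density turns the
  parameter \<open>1 - l_d / r\<close> of the former into \<open>1 - (l_d + l_e) / r - (1 - l_d / r) = - l_e / r\<close>.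
  With \<open>- l_d / r\<close> the identity is false whenever \<open>l_d \<noteq> l_e\<close>; the theorem uses \<open>- l_e / r\<close>.
\<close>

end

theory Submission
  imports Defs
begin

text \<open>
  The density of the eavesdropper SNR is a stretched exponential, by the Cahen--Mellin integral
  \<open>G [z] = exp (- z)\<close>. Insert the Mellin--Barnes integral of the distribution function of the
  destination SNR along a vertical line and exchange the two integrations: the inner one is Euler's
  integral for Gamma, split by the duplication formula if \<open>r = 2\<close>. The reflection
  \<open>s \<mapsto> (l_d + l_e) / r - s\<close> turns the remaining integral into the Mellin--Barnes integral of the
  closed form.

  Decay faster than every power on vertical strips is all that is needed of Gamma, both for the
  independence of a G-function from the separating contour and for the convergence along a line.
\<close>

section \<open>Independence of the contour\<close>

text \<open>\<open>meijer_G\<close> is a definite description over all separating contours, so no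
  value can be computed before all such contours are known to agree. Only then may a vertical line
  be used, where the integral converges absolutely. Write \<rho> = l_d / r and \<nu> = l_e / r. In
  both G-functions with r + 1 lower parameters one upper and one lower parameter are tuned so that a
  Gamma quotient collapses. For the distribution function it is Gamma (\<rho> - s) / Gamma (1 +
  \<rho> - s) = 1 / (\<rho> - s). Thus Gamma has to be estimated only from above. Under s = \<rho> +
  \<nu> - w this factor becomes 1 / (w - \<nu>) = Gamma (w - \<nu>) / Gamma (1 - \<nu> + w), which
  is the origin of the lower parameter - \<nu> and of the upper parameter 1 - \<nu> = \<omega> +
  \<rho>. The exchange of integrals is harmless because x powr (- i t) has modulus 1: in absolute
  value the double integrand is a function of t times a function of x.\<close>

text \<open>The exponents that matter: 1 makes horizontal segments vanish at infinity, 2 makes the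
  integral along a vertical line absolutely convergent, 0 is mere boundedness of a factor. The
  threshold \<open>Y\<close> may depend on the strip and keeps the estimate away from poles.\<close>

definition strip_decay :: "nat \<Rightarrow> (complex \<Rightarrow> complex) \<Rightarrow> bool" where
  "strip_decay N f \<longleftrightarrow>
     (\<forall>R. \<exists>C Y. \<forall>s. \<bar>Re s\<bar> \<le> R \<longrightarrow> \<bar>Im s\<bar> \<ge> Y \<longrightarrow> norm (f s) * \<bar>Im s\<bar> ^ N \<le> C)"

lemma strip_decayE:
  assumes "strip_decay N f"
  obtains C Y where "C > 0" "Y > 0"
    "\<And>s. \<bar>Re s\<bar> \<le> R \<Longrightarrow> \<bar>Im s\<bar> \<ge> Y \<Longrightarrow> norm (f s) * \<bar>Im s\<bar> ^ N \<le> C"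
proof -
  obtain C Y where *: "\<And>s. \<bar>Re s\<bar> \<le> R \<Longrightarrow> \<bar>Im s\<bar> \<ge> Y \<Longrightarrow> norm (f s) * \<bar>Im s\<bar> ^ N \<le> C"
    using assms unfolding strip_decay_def by blast
  show ?thesis
  proof (rule that[of "max C 1" "max Y 1"])
    fix s :: complex assume "\<bar>Re s\<bar> \<le> R" "max Y 1 \<le> \<bar>Im s\<bar>"
    then show "norm (f s) * \<bar>Im s\<bar> ^ N \<le> max C 1" using *[of s] by linarith
  qed auto
qed

lemma strip_decayI:
  assumes "\<And>R. R > 0 \<Longrightarrow> \<exists>C Y. \<forall>s. \<bar>Re s\<bar> \<le> R \<longrightarrow> \<bar>Im s\<bar> \<ge> Y \<longrightarrow> norm (f s) * \<bar>Im s\<bar> ^ N \<le> C"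
  shows "strip_decay N f"
  unfolding strip_decay_def
proof
  fix R :: real
  obtain C Y where "\<forall>s. \<bar>Re s\<bar> \<le> max R 1 \<longrightarrow> \<bar>Im s\<bar> \<ge> Y \<longrightarrow> norm (f s) * \<bar>Im s\<bar> ^ N \<le> C"
    using assms[of "max R 1"] by (meson less_max_iff_disj zero_less_one)
  then show "\<exists>C Y. \<forall>s. \<bar>Re s\<bar> \<le> R \<longrightarrow> \<bar>Im s\<bar> \<ge> Y \<longrightarrow> norm (f s) * \<bar>Im s\<bar> ^ N \<le> C"
    by (intro exI[of _ C] exI[of _ Y]) auto
qed

lemma strip_decay_mult:
  assumes "strip_decay M f" "strip_decay N g"
  shows "strip_decay (M + N) (\<lambda>s. f s * g s)"
proof (rule strip_decayI)
  fix R :: real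
  obtain C Y where C: "C > 0" "Y > 0"
    "\<And>s. \<bar>Re s\<bar> \<le> R \<Longrightarrow> \<bar>Im s\<bar> \<ge> Y \<Longrightarrow> norm (f s) * \<bar>Im s\<bar> ^ M \<le> C"
    by (rule strip_decayE[OF assms(1), where R = R], rule that)
  obtain D Z where D: "D > 0" "Z > 0"
    "\<And>s. \<bar>Re s\<bar> \<le> R \<Longrightarrow> \<bar>Im s\<bar> \<ge> Z \<Longrightarrow> norm (g s) * \<bar>Im s\<bar> ^ N \<le> D"
    by (rule strip_decayE[OF assms(2), where R = R], rule that)
  show "\<exists>C Y. \<forall>s. \<bar>Re s\<bar> \<le> R \<longrightarrow> \<bar>Im s\<bar> \<ge> Y \<longrightarrow> norm (f s * g s) * \<bar>Im s\<bar> ^ (M + N) \<le> C"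
  proof (intro exI allI impI)
    fix s assume s: "\<bar>Re s\<bar> \<le> R" "max Y Z \<le> \<bar>Im s\<bar>"
    have "norm (f s * g s) * \<bar>Im s\<bar> ^ (M + N) = (norm (f s) * \<bar>Im s\<bar> ^ M) * (norm (g s) * \<bar>Im s\<bar> ^ N)"
      by (simp add: norm_mult power_add)
    also have "\<dots> \<le> C * D"
      using s C D by (intro mult_mono) auto
    finally show "norm (f s * g s) * \<bar>Im s\<bar> ^ (M + N) \<le> C * D" .
  qed
qed

text \<open>Only large heights matter. So an integrand may be replaced by a simplified form that
  differs from it at real poles, where Gamma has the default value 0.\<close>

lemma strip_decay_cong:
  assumes "\<And>s. \<bar>Im s\<bar> \<ge> Y \<Longrightarrow> f s = g s" "strip_decay N g"
  shows "strip_decay N f"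
proof (rule strip_decayI)
  fix R :: real
  obtain C Z where C: "C > 0" "Z > 0"
    "\<And>s. \<bar>Re s\<bar> \<le> R \<Longrightarrow> \<bar>Im s\<bar> \<ge> Z \<Longrightarrow> norm (g s) * \<bar>Im s\<bar> ^ N \<le> C"
    by (rule strip_decayE[OF assms(2), where R = R], rule that)
  then show "\<exists>C Y. \<forall>s. \<bar>Re s\<bar> \<le> R \<longrightarrow> \<bar>Im s\<bar> \<ge> Y \<longrightarrow> norm (f s) * \<bar>Im s\<bar> ^ N \<le> C"
    using assms(1) by (intro exI[of _ C] exI[of _ "max Y Z"]) auto
qed

lemma strip_decay_inverse_diff: "strip_decay 1 (\<lambda>s. 1 / (s - p))"
proof (rule strip_decayI)
  fix R :: real
  show "\<exists>C Y. \<forall>s. \<bar>Re s\<bar> \<le> R \<longrightarrow> \<bar>Im s\<bar> \<ge> Y \<longrightarrow> norm (1 / (s - p)) * \<bar>Im s\<bar> ^ 1 \<le> C"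
  \<comment> \<open>Above this height \<open>\<bar>Im (s - p)\<bar>\<close> is at least half of
    \<open>\<bar>Im s\<bar>\<close>; hence the constant 2.\<close>
  proof (rule exI[of _ 2], rule exI[of _ "2 * \<bar>Im p\<bar> + 1"], intro allI impI)
    fix s assume s: "2 * \<bar>Im p\<bar> + 1 \<le> \<bar>Im s\<bar>"
    have "x \<le> 2 * z \<and> 0 < z" if "2 * y + 1 \<le> x" "x - y \<le> z" "0 \<le> y" for x y z :: real
      using that by linarith
    from this[OF s abs_triangle_ineq2] have "\<bar>Im s\<bar> \<le> 2 * \<bar>Im (s - p)\<bar> \<and> \<bar>Im (s - p)\<bar> > 0"
      unfolding minus_complex.sel using abs_ge_zero by blast
    then have "\<bar>Im s\<bar> \<le> 2 * norm (s - p)" "norm (s - p) > 0"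
      using abs_Im_le_cmod[of "s - p"] by linarith+
    then show "norm (1 / (s - p)) * \<bar>Im s\<bar> ^ 1 \<le> 2"
      by (simp add: norm_divide field_simps)
  qed
qed

lemma strip_decay_mono:
  assumes "strip_decay N f" "M \<le> N"
  shows "strip_decay M f"
proof (rule strip_decayI)
  fix R :: real
  obtain C Y where C: "C > 0" "Y > 0"
    "\<And>s. \<bar>Re s\<bar> \<le> R \<Longrightarrow> \<bar>Im s\<bar> \<ge> Y \<Longrightarrow> norm (f s) * \<bar>Im s\<bar> ^ N \<le> C"
    by (rule strip_decayE[OF assms(1), where R = R], rule that)
  show "\<exists>C Y. \<forall>s. \<bar>Re s\<bar> \<le> R \<longrightarrow> \<bar>Im s\<bar> \<ge> Y \<longrightarrow> norm (f s) * \<bar>Im s\<bar> ^ M \<le> C"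
  proof (intro exI allI impI)
    fix s assume s: "\<bar>Re s\<bar> \<le> R" "max Y 1 \<le> \<bar>Im s\<bar>"
    have "norm (f s) * \<bar>Im s\<bar> ^ M \<le> norm (f s) * \<bar>Im s\<bar> ^ N"
      using s assms(2) by (intro mult_left_mono power_increasing) auto
    also have "\<dots> \<le> C" using C s by auto
    finally show "norm (f s) * \<bar>Im s\<bar> ^ M \<le> C" .
  qed
qed

section \<open>Horizontal segments far from the real axis\<close>

lemma Im_closed_segment:
  assumes "s \<in> closed_segment (Complex a X) (Complex b X)"
  shows "Im s = X" "\<bar>Re s\<bar> \<le> max \<bar>a\<bar> \<bar>b\<bar>"
proof -
  obtain u where "s = (1 - u) *\<^sub>R Complex a X + u *\<^sub>R Complex b X"
    using assms by (auto simp: closed_segment_def)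
  then have "Im s = (1 - u) * X + u * X" by simp
  then show 1: "Im s = X" by (simp add: algebra_simps)
  have "Re s \<in> closed_segment a b"
    using assms by (auto simp: closed_segment_def)
  then show "\<bar>Re s\<bar> \<le> max \<bar>a\<bar> \<bar>b\<bar>"
    by (auto simp: closed_segment_eq_real_ivl split: if_splits)
qed

text \<open>The segment can only meet poles whose real part is in its range; these are finitely
  many, so their heights are bounded. The filter \<open>at_infinity\<close> covers X and - X, hence
  the upper and the lower edge of a loop.\<close>

lemma eventually_closed_segment_disjoint:
  assumes "\<And>R. finite {p \<in> P. \<bar>Re p\<bar> \<le> R}"
  shows "\<forall>\<^sub>F X in at_infinity. closed_segment (Complex a X) (Complex b X) \<inter> P = {}"
proof -
  define F where "F = {p \<in> P. \<bar>Re p\<bar> \<le> max \<bar>a\<bar> \<bar>b\<bar>}"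
  have "finite (Im ` F)" using assms unfolding F_def by auto
  then obtain B where B: "\<And>y. y \<in> Im ` F \<Longrightarrow> norm y \<le> B"
    using finite_imp_bounded bounded_iff by metis
  have "\<forall>\<^sub>F X in at_infinity. norm (X::real) \<ge> B + 1"
    unfolding eventually_at_infinity by auto
  then show ?thesis
  proof eventually_elim
    case (elim X)
    have False if "s \<in> closed_segment (Complex a X) (Complex b X)" "s \<in> P" for s
    proof -
      have "s \<in> F" using Im_closed_segment[OF that(1)] that(2) by (auto simp: F_def)
      then have "norm X \<le> B" using B[of "Im s"] Im_closed_segment(1)[OF that(1)] by auto
      then show False using elim by auto
    qed
    then show ?case by auto
  qed
qed

text \<open>The length \<open>\<bar>b - a\<bar>\<close> is fixed and the integrand is at most C /
  \<open>\<bar>X\<bar>\<close>, so decay of order 1 is enough.\<close>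

lemma horizontal_contour_integral_tendsto_0:
  assumes cont: "continuous_on (-P) f" and fin: "\<And>R. finite {p \<in> P. \<bar>Re p\<bar> \<le> R}"
    and dec: "strip_decay 1 f"
  shows "((\<lambda>X. contour_integral (linepath (Complex a X) (Complex b X)) f) \<longlongrightarrow> 0) at_infinity"
proof -
  obtain C Y where C: "C > 0" "Y > 0"
    "\<And>s. \<bar>Re s\<bar> \<le> max \<bar>a\<bar> \<bar>b\<bar> \<Longrightarrow> \<bar>Im s\<bar> \<ge> Y \<Longrightarrow> norm (f s) * \<bar>Im s\<bar> ^ 1 \<le> C"
    by (rule strip_decayE[OF dec, where R = "max \<bar>a\<bar> \<bar>b\<bar>"], rule that)
  have "\<forall>\<^sub>F X in at_infinity. norm (X::real) \<ge> Y"
    unfolding eventually_at_infinity by auto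
  with eventually_closed_segment_disjoint[OF fin, of a b]
  have bound: "\<forall>\<^sub>F X in at_infinity.
      norm (contour_integral (linepath (Complex a X) (Complex b X)) f) \<le> C * \<bar>b - a\<bar> * inverse (norm X)"
  proof eventually_elim
    case (elim X)
    have "closed_segment (Complex a X) (Complex b X) \<subseteq> -P" using elim by auto
    then have int: "f contour_integrable_on linepath (Complex a X) (Complex b X)"
      using cont continuous_on_subset by (intro contour_integrable_continuous_linepath) blast
    have "norm (contour_integral (linepath (Complex a X) (Complex b X)) f)
        \<le> (C / norm X) * norm (Complex b X - Complex a X)"
    proof (rule contour_integral_bound_linepath[OF int])
      fix s assume "s \<in> closed_segment (Complex a X) (Complex b X)"
      from Im_closed_segment[OF this] have "norm (f s) * \<bar>X\<bar> ^ 1 \<le> C"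
        using C(3)[of s] elim by auto
      then show "norm (f s) \<le> C / norm X" using elim C by (simp add: field_simps)
    qed (use C in auto)
    also have "Complex b X - Complex a X = of_real (b - a)" by (simp add: complex_eq_iff)
    finally show ?case by (simp add: field_simps del: of_real_diff)
  qed
  have "((\<lambda>X::real. C * \<bar>b - a\<bar> * inverse (norm X)) \<longlongrightarrow> C * \<bar>b - a\<bar> * 0) at_infinity"
    by (intro tendsto_intros tendsto_inverse_0_at_top filterlim_norm_at_top)
  then have "((\<lambda>X::real. C * \<bar>b - a\<bar> * inverse (norm X)) \<longlongrightarrow> 0) at_infinity" by simp
  then show ?thesis by (rule Lim_null_comparison[OF bound])
qed

text \<open>The integrand 1 / (w - p) of the winding number has itself decay of order 1, so this is
  the preceding lemma with the single pole p.\<close>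

lemma horizontal_winding_number_tendsto_0:
  "((\<lambda>X. winding_number (linepath (Complex a X) (Complex b X)) p) \<longlongrightarrow> 0) at_infinity"
proof -
  have "((\<lambda>X. 1 / (2 * pi * \<i>) * contour_integral (linepath (Complex a X) (Complex b X)) (\<lambda>w. 1 / (w - p)))
      \<longlongrightarrow> 1 / (2 * pi * \<i>) * 0) at_infinity"
    by (intro tendsto_intros horizontal_contour_integral_tendsto_0[of "{p}"] strip_decay_inverse_diff)
       (auto intro!: continuous_intros)
  moreover have "\<forall>\<^sub>F X in at_infinity.
      1 / (2 * pi * \<i>) * contour_integral (linepath (Complex a X) (Complex b X)) (\<lambda>w. 1 / (w - p)) =
      winding_number (linepath (Complex a X) (Complex b X)) p"
    using eventually_closed_segment_disjoint[of "{p}" a b]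
    by (auto elim!: eventually_mono simp: winding_number_valid_path)
  ultimately show ?thesis
    using Lim_transform_eventually by fastforce
qed

section \<open>Truncated contours and the loop formed by two of them\<close>

lemma truncated_contour_simps [simp]:
  "pathstart (truncated_contour g X) = Complex (Re (pathstart g)) (- X)"
  "pathfinish (truncated_contour g X) = Complex (Re (pathfinish g)) X"
  "path_image (truncated_contour g X) =
     closed_segment (Complex (Re (pathstart g)) (- X)) (pathstart g) \<union> path_image g \<union>
     closed_segment (pathfinish g) (Complex (Re (pathfinish g)) X)"
  by (simp_all add: truncated_contour_def path_image_join Un_assoc)

lemma valid_path_truncated_contour:
  "valid_path g \<Longrightarrow> valid_path (truncated_contour g X)"
  by (simp add: truncated_contour_def valid_path_join)

lemma convex_vertical_strip: "convex {z. \<bar>Re z\<bar> \<le> R}"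
proof -
  have "{z. \<bar>Re z\<bar> \<le> R} = {z. Re z \<le> R} \<inter> {z. Re z \<ge> -R}" by auto
  then show ?thesis by (simp add: convex_halfspace_Re_le convex_halfspace_Re_ge convex_Int)
qed

lemma Re_truncated_contour:
  assumes "path_image g \<subseteq> {z. \<bar>Re z\<bar> \<le> R}"
  shows "path_image (truncated_contour g X) \<subseteq> {z. \<bar>Re z\<bar> \<le> R}"
proof -
  have *: "pathstart g \<in> {z. \<bar>Re z\<bar> \<le> R}" "pathfinish g \<in> {z. \<bar>Re z\<bar> \<le> R}"
    using assms pathstart_in_path_image[of g] pathfinish_in_path_image[of g] by blast+
  have "closed_segment (Complex (Re (pathstart g)) (- X)) (pathstart g) \<subseteq> {z. \<bar>Re z\<bar> \<le> R}"
    using * by (intro closed_segment_subset convex_vertical_strip) auto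
  moreover have "closed_segment (pathfinish g) (Complex (Re (pathfinish g)) X) \<subseteq> {z. \<bar>Re z\<bar> \<le> R}"
    using * by (intro closed_segment_subset convex_vertical_strip) auto
  ultimately show ?thesis using assms by simp
qed


text \<open>\<open>contour_index\<close> provides only limits, whereas Cauchy's theorem asks for
  winding number exactly 0; integrality of the winding number of a loop bridges the gap.\<close>

lemma Ints_tendsto_0_imp_eventually_eq_0:
  fixes k :: "'a \<Rightarrow> complex"
  assumes "(k \<longlongrightarrow> 0) F" "\<forall>\<^sub>F x in F. k x \<in> \<int>"
  shows "\<forall>\<^sub>F x in F. k x = 0"
proof -
  have "\<forall>\<^sub>F x in F. dist (k x) 0 < 1" using assms(1) by (rule tendstoD) auto
  with assms(2) show ?thesis
  proof eventually_elim
    case (elim x)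
    then obtain n where "k x = of_int n" by (auto elim: Ints_cases)
    with elim(2) show ?case by simp
  qed
qed

text \<open>
  Closing up two truncated contours by horizontal segments gives a loop whose winding number about
  each pole tends to \<open>1/2 - 1/2 = 0\<close>, hence is eventually \<open>0\<close>. Far poles are handled uniformly:
  the loop stays in a vertical strip that does not depend on the truncation height.
\<close>

lemma contour_difference_tendsto_0:
  assumes "closed (A \<union> B)" and holo: "f holomorphic_on - (A \<union> B)"
    and fin: "\<And>R. finite {p \<in> A \<union> B. \<bar>Re p\<bar> \<le> R}"
    and dec: "strip_decay 1 f"
    and g: "contour_separates g A B" and h: "contour_separates h A B"
  shows "((\<lambda>X. contour_integral (truncated_contour g X) f -
               contour_integral (truncated_contour h X) f) \<longlongrightarrow> 0) at_top"
proof -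
  define P where "P = A \<union> B"
  have holo: "f holomorphic_on -P" and fin: "\<And>R. finite {p \<in> P. \<bar>Re p\<bar> \<le> R}" and "closed P"
    using assms by (auto simp: P_def)
  have cont: "continuous_on (-P) f" using holo by (rule holomorphic_on_imp_continuous_on)
  have vp: "valid_path g" "valid_path h" using g h by (auto simp: contour_separates_def)
  define T where "T = (\<lambda>X. linepath (Complex (Re (pathfinish g)) X) (Complex (Re (pathfinish h)) X))"
  define U where "U = (\<lambda>X. linepath (Complex (Re (pathstart h)) (-X)) (Complex (Re (pathstart g)) (-X)))"
  define G where "G = truncated_contour g"
  define H where "H = truncated_contour h"
  \<comment> \<open>Up along \<open>g\<close>, across at height X, down along \<open>h\<close>, back
    across at height - X.\<close>
  define W where "W = (\<lambda>X. G X +++ (T X +++ (reversepath (H X) +++ U X)))"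
  have GH: "valid_path (G X)" "valid_path (H X)" "path (G X)" "path (H X)" "path (T X)" "path (U X)" for X
    using vp by (auto simp: G_def H_def T_def U_def valid_path_truncated_contour valid_path_imp_path)
  have ends: "pathstart (T X) = pathfinish (G X)" "pathfinish (T X) = pathfinish (H X)"
     "pathstart (U X) = pathstart (H X)" "pathfinish (U X) = pathstart (G X)" for X
    by (auto simp: T_def U_def G_def H_def)
  have W: "valid_path (W X)" "pathfinish (W X) = pathstart (W X)"
     "path_image (W X) = path_image (G X) \<union> path_image (T X) \<union> path_image (H X) \<union> path_image (U X)" for X
    using GH[of X] ends[of X]
    by (auto simp: W_def path_image_join valid_path_join T_def[symmetric] U_def[symmetric])
       (auto simp: W_def path_image_join valid_path_join T_def U_def)
  have top: "filterlim (\<lambda>X::real. X) at_infinity at_top"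
    by (simp add: filterlim_def at_top_le_at_infinity)
  have bot: "filterlim (\<lambda>X::real. - X) at_infinity at_top"
    using filterlim_uminus_at_bot_at_top at_bot_le_at_infinity filterlim_mono by blast
  have off: "\<forall>\<^sub>F X in at_top. p \<notin> path_image (W X)" if "p \<in> P" for p
  proof -
    have "\<forall>\<^sub>F X in at_top. p \<notin> path_image (G X)" "\<forall>\<^sub>F X in at_top. p \<notin> path_image (H X)"
      using g h that by (auto simp: contour_separates_def contour_index_def P_def G_def H_def)
    moreover have "\<forall>\<^sub>F X in at_top. p \<notin> path_image (T X)"
      using eventually_compose_filterlim[OF eventually_closed_segment_disjoint[of "{p}"] top]
      by (simp add: T_def)
    moreover have "\<forall>\<^sub>F X in at_top. p \<notin> path_image (U X)"
      using eventually_compose_filterlim[OF eventually_closed_segment_disjoint[of "{p}"] bot]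
      by (simp add: U_def)
    ultimately show ?thesis by eventually_elim (simp add: W)
  qed
  have wn: "\<forall>\<^sub>F X in at_top. winding_number (W X) p = 0" if p: "p \<in> P" for p
  proof (rule Ints_tendsto_0_imp_eventually_eq_0)
    show "\<forall>\<^sub>F X in at_top. winding_number (W X) p \<in> \<int>"
      using off[OF p] by eventually_elim (simp add: integer_winding_number W valid_path_imp_path)
    \<comment> \<open>The same k serves both contours, 1/2 on \<open>A\<close> and - 1/2 on
      \<open>B\<close>; traversing \<open>h\<close> backwards makes the two cancel.\<close>
    obtain k where k: "((\<lambda>X. winding_number (G X) p) \<longlongrightarrow> k) at_top" "((\<lambda>X. winding_number (H X) p) \<longlongrightarrow> k) at_top"
      using g h p unfolding contour_separates_def contour_index_def P_def G_def H_def by blast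
    have TU: "((\<lambda>X. winding_number (T X) p) \<longlongrightarrow> 0) at_top" "((\<lambda>X. winding_number (U X) p) \<longlongrightarrow> 0) at_top"
      unfolding T_def U_def
      by (rule filterlim_compose[OF horizontal_winding_number_tendsto_0 top]
          filterlim_compose[OF horizontal_winding_number_tendsto_0 bot])+
    have "((\<lambda>X. winding_number (G X) p + (winding_number (T X) p +
        (- winding_number (H X) p + winding_number (U X) p))) \<longlongrightarrow> k + (0 + (- k + 0))) at_top"
      by (intro tendsto_intros k TU)
    moreover have "\<forall>\<^sub>F X in at_top. winding_number (G X) p + (winding_number (T X) p +
        (- winding_number (H X) p + winding_number (U X) p)) = winding_number (W X) p"
      using off[OF p]
    proof eventually_elim
      case (elim X)
      then have "p \<notin> path_image (G X)" "p \<notin> path_image (T X)" "p \<notin> path_image (H X)" "p \<notin> path_image (U X)"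
        by (auto simp: W)
      then show ?case using GH[of X] ends[of X]
        by (simp add: W_def winding_number_join path_image_join winding_number_reversepath)
    qed
    ultimately show "((\<lambda>X. winding_number (W X) p) \<longlongrightarrow> 0) at_top"
      using Lim_transform_eventually by fastforce
  qed
  obtain R where R: "\<And>X. path_image (W X) \<subseteq> {z. \<bar>Re z\<bar> \<le> R}"
  proof -
    have "bounded (path_image g \<union> path_image h)"
      using vp by (simp add: bounded_path_image valid_path_imp_path)
    then obtain R where "\<And>z. z \<in> path_image g \<union> path_image h \<Longrightarrow> norm z \<le> R"
      using bounded_iff by metis
    then have R: "path_image g \<subseteq> {z. \<bar>Re z\<bar> \<le> R}" "path_image h \<subseteq> {z. \<bar>Re z\<bar> \<le> R}"
      using abs_Re_le_cmod order_trans by blast+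
    have "path_image (W X) \<subseteq> {z. \<bar>Re z\<bar> \<le> R}" for X
    proof -
      have 1: "path_image (G X) \<subseteq> {z. \<bar>Re z\<bar> \<le> R}" "path_image (H X) \<subseteq> {z. \<bar>Re z\<bar> \<le> R}"
        using R by (auto simp: G_def H_def simp del: truncated_contour_simps dest!: Re_truncated_contour[of _ _ X])
      then have "pathstart (G X) \<in> {z. \<bar>Re z\<bar> \<le> R}" "pathfinish (G X) \<in> {z. \<bar>Re z\<bar> \<le> R}"
          "pathstart (H X) \<in> {z. \<bar>Re z\<bar> \<le> R}" "pathfinish (H X) \<in> {z. \<bar>Re z\<bar> \<le> R}"
        by blast+
      then have "path_image (T X) \<subseteq> {z. \<bar>Re z\<bar> \<le> R}" "path_image (U X) \<subseteq> {z. \<bar>Re z\<bar> \<le> R}"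
        unfolding T_def U_def G_def H_def path_image_linepath
        by (intro closed_segment_subset convex_vertical_strip; simp)+
      with 1 show ?thesis by (simp add: W)
    qed
    then show ?thesis using that by blast
  qed
  have fin: "finite {p \<in> P. \<bar>Re p\<bar> \<le> R}" using fin .
  \<comment> \<open>\<open>off\<close> and \<open>wn\<close> give one threshold for each pole, so
    they combine only over a finite set; the poles beyond the strip are left to its
    convexity.\<close>
  have "\<forall>\<^sub>F X in at_top. \<forall>p\<in>{p \<in> P. \<bar>Re p\<bar> \<le> R}. p \<notin> path_image (W X) \<and> winding_number (W X) p = 0"
    using off wn by (intro eventually_ball_finite fin ballI eventually_conj) auto
  then have diff: "\<forall>\<^sub>F X in at_top. - contour_integral (T X) f - contour_integral (U X) f =
      contour_integral (G X) f - contour_integral (H X) f"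
  proof eventually_elim
    case (elim X)
    have sub: "path_image (W X) \<subseteq> - P" using elim R[of X] by auto
    have "winding_number (W X) p = 0" if "p \<notin> -P" for p
    proof (cases "\<bar>Re p\<bar> \<le> R")
      case False
      then show ?thesis using R[of X]
        by (intro winding_number_zero_outside[OF _ convex_vertical_strip W(2)] valid_path_imp_path[OF W(1)]) auto
    qed (use elim that in auto)
    then have 0: "(f has_contour_integral 0) (W X)"
      using \<open>closed P\<close> sub W holo by (intro Cauchy_theorem_global[of "-P"]) auto
    have int: "f contour_integrable_on q" if "valid_path q" "path_image q \<subseteq> -P" for q
      using that holo \<open>closed P\<close> by (intro contour_integrable_holomorphic_simple[of _ "-P"]) auto
    have "f contour_integrable_on G X" "f contour_integrable_on T X" "f contour_integrable_on H X"
         "f contour_integrable_on U X"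
      using sub vp by (intro int GH; simp add: W T_def U_def)+
    moreover have "valid_path (T X)" "valid_path (U X)" by (auto simp: T_def U_def)
    ultimately have "contour_integral (W X) f = contour_integral (G X) f + (contour_integral (T X) f
      + (- contour_integral (H X) f + contour_integral (U X) f))"
      using ends[of X] GH[of X]
      by (simp add: W_def contour_integral_join valid_path_join contour_integrable_join
            contour_integrable_reversepath contour_integral_reversepath)
    with contour_integral_unique[OF 0] show ?case by (simp add: algebra_simps)
  qed
  have "((\<lambda>X. contour_integral (T X) f) \<longlongrightarrow> 0) at_top" "((\<lambda>X. contour_integral (U X) f) \<longlongrightarrow> 0) at_top"
    unfolding T_def U_def
    by (rule filterlim_compose[OF horizontal_contour_integral_tendsto_0[OF cont _ dec] top]
          filterlim_compose[OF horizontal_contour_integral_tendsto_0[OF cont _ dec] bot];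
        use assms(3) in \<open>simp add: P_def\<close>)+
  then have "((\<lambda>X. - contour_integral (T X) f - contour_integral (U X) f) \<longlongrightarrow> - 0 - 0) at_top"
    by (intro tendsto_intros)
  then show ?thesis
    using Lim_transform_eventually[OF _ diff] by (simp add: G_def H_def)
qed

section \<open>Vertical lines as separating contours\<close>

text \<open>The finite piece degenerates to a constant path; the two half-lines added by
  \<open>truncated_contour\<close> make up the whole line.\<close>

abbreviation vline :: "real \<Rightarrow> real \<Rightarrow> complex" where
  "vline c \<equiv> linepath (of_real c) (of_real c)"

lemma closed_segment_same_Re:
  assumes "Re a = c" "Re b = c"
  shows "closed_segment a b \<subseteq> {s. Re s = c}"
proof
  fix s assume "s \<in> closed_segment a b"
  then obtain u where "s = (1 - u) *\<^sub>R a + u *\<^sub>R b"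
    by (auto simp: closed_segment_def)
  then have "Re s = (1 - u) * c + u * c" using assms by simp
  then show "s \<in> {s. Re s = c}" by (simp add: algebra_simps)
qed

lemma Re_truncated_vline: "path_image (truncated_contour (vline c) X) \<subseteq> {s. Re s = c}"
  by (simp add: closed_segment_same_Re)

lemma contour_integral_truncated_vline:
  assumes "continuous_on {s. Re s = c} f" "X > 0"
  shows "contour_integral (truncated_contour (vline c) X) f = \<i> * integral {-X..X} (\<lambda>t. f (Complex c t))"
proof -
  have seg: "closed_segment a b \<subseteq> {s. Re s = c}" if "Re a = c" "Re b = c" for a b
    using that by (rule closed_segment_same_Re)
  have int: "f contour_integrable_on linepath a b" if "Re a = c" "Re b = c" for a b
    using seg[OF that] assms(1) by (intro contour_integrable_continuous_linepath) (rule continuous_on_subset)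
  have "contour_integral (truncated_contour (vline c) X) f =
     contour_integral (linepath (Complex c (-X)) (of_real c)) f +
     contour_integral (linepath (of_real c) (Complex c X)) f"
    using int by (simp add: truncated_contour_def contour_integrable_join valid_path_join)
  also have "\<dots> = contour_integral (linepath (Complex c (-X)) (Complex c X)) f"
  proof (rule contour_integral_split_linepath[symmetric])
    show "continuous_on (closed_segment (Complex c (- X)) (Complex c X)) f"
      using seg assms(1) by (intro continuous_on_subset[OF assms(1)]) auto
    show "complex_of_real c \<in> closed_segment (Complex c (- X)) (Complex c X)"
      unfolding closed_segment_def by (auto intro!: exI[of _ "1/2"] simp: complex_eq_iff)
  qed
  also have "\<dots> = \<i> * integral {-X..X} (\<lambda>t. f (Complex c t))"
    using assms(2) by (intro contour_integral_linepath_same_Re) auto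
  finally show ?thesis .
qed

text \<open>Dividing both arguments by X > 0 does not change the difference of the logarithms, and
  the arguments then tend to i and - i, where \<open>Ln\<close> is continuous.\<close>

lemma Ln_vertical_tendsto:
  assumes "Re w > 0"
  shows "((\<lambda>X. Ln (w + \<i> * of_real X) - Ln (w - \<i> * of_real X)) \<longlongrightarrow> \<i> * pi) at_top"
proof -
  have lim: "((\<lambda>X. w / of_real X) \<longlongrightarrow> 0) at_top"
    by (rule tendsto_divide_0[OF tendsto_const])
       (simp add: filterlim_at_infinity_conv_norm_at_top filterlim_abs_real)
  have "((\<lambda>X. Ln (w / of_real X + \<i>) - Ln (w / of_real X + - \<i>)) \<longlongrightarrow> Ln (0 + \<i>) - Ln (0 + - \<i>)) at_top"
    by (intro tendsto_intros lim) (auto simp: complex_nonpos_Reals_iff)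
  then have "((\<lambda>X. Ln (w / of_real X + \<i>) - Ln (w / of_real X + - \<i>)) \<longlongrightarrow> \<i> * pi) at_top"
    by (simp add: field_simps)
  moreover have "\<forall>\<^sub>F X in at_top. Ln (w / of_real X + \<i>) - Ln (w / of_real X + - \<i>) =
      Ln (w + \<i> * of_real X) - Ln (w - \<i> * of_real X)"
    using eventually_gt_at_top[of "0::real"]
  proof eventually_elim
    case (elim X)
    have eq: "w / of_real X + \<i> = (w + \<i> * of_real X) / of_real X"
       "w / of_real X + - \<i> = (w - \<i> * of_real X) / of_real X"
      using elim by (simp_all add: field_simps)
    have "w + \<i> * of_real X \<noteq> 0" "w - \<i> * of_real X \<noteq> 0"
      using assms by (auto simp: complex_eq_iff)
    then show ?case using elim unfolding eq by (simp add: Ln_divide_of_real)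
  qed
  ultimately show ?thesis by (rule Lim_transform_eventually)
qed

text \<open>Along the line, w - p has positive real part if p lies to the left, and p - w if p lies
  to the right. So \<open>Ln (w - p)\<close> and \<open>Ln (p - w)\<close>, respectively, are
  primitives of 1 / (w - p) that stay off the branch cut. In the second one the two ends appear
  conjugated, which gives the opposite sign.\<close>

lemma contour_index_vline:
  shows contour_index_vline_left: "Re p < c \<Longrightarrow> contour_index (vline c) p (1/2)"
    and contour_index_vline_right: "Re p > c \<Longrightarrow> contour_index (vline c) p (-1/2)"
proof -
  have off: "p \<notin> path_image (truncated_contour (vline c) X)" if "Re p \<noteq> c" for X
    using that Re_truncated_vline by blast
  have wn: "winding_number (truncated_contour (vline c) X) p =
     1 / (2 * pi * \<i>) * contour_integral (truncated_contour (vline c) X) (\<lambda>w. 1 / (w - p))" if "Re p \<noteq> c" for X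
    using off[OF that] by (simp add: winding_number_valid_path valid_path_truncated_contour del: truncated_contour_simps)
  show "contour_index (vline c) p (1/2)" if p: "Re p < c"
  proof -
    have "((\<lambda>w. 1 / (w - p)) has_contour_integral Ln (pathfinish (truncated_contour (vline c) X) - p)
         - Ln (pathstart (truncated_contour (vline c) X) - p)) (truncated_contour (vline c) X)" for X
      by (rule contour_integral_primitive[OF _ _ Re_truncated_vline])
         (use p in \<open>auto intro!: derivative_eq_intros valid_path_truncated_contour
             simp: complex_nonpos_Reals_iff field_simps\<close>)
    from contour_integral_unique[OF this]
    have ci: "contour_integral (truncated_contour (vline c) X) (\<lambda>w. 1 / (w - p)) =
       Ln ((of_real c - p) + \<i> * of_real X) - Ln ((of_real c - p) - \<i> * of_real X)" for X
      by (simp add: Complex_eq algebra_simps)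
    have eq: "winding_number (truncated_contour (vline c) X) p =
       1 / (2 * pi * \<i>) * (Ln ((of_real c - p) + \<i> * of_real X) - Ln ((of_real c - p) - \<i> * of_real X))" for X
      using p by (simp only: wn ci)
    have "((\<lambda>X. winding_number (truncated_contour (vline c) X) p) \<longlongrightarrow> 1 / (2 * pi * \<i>) * (\<i> * pi)) at_top"
      unfolding eq using p by (intro tendsto_intros Ln_vertical_tendsto) auto
    then show ?thesis using off p by (simp add: contour_index_def del: truncated_contour_simps)
  qed
  show "contour_index (vline c) p (-1/2)" if p: "Re p > c"
  proof -
    have "((\<lambda>w. 1 / (w - p)) has_contour_integral Ln (p - pathfinish (truncated_contour (vline c) X))
         - Ln (p - pathstart (truncated_contour (vline c) X))) (truncated_contour (vline c) X)" for X
      by (rule contour_integral_primitive[OF _ _ Re_truncated_vline])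
         (use p in \<open>auto intro!: derivative_eq_intros valid_path_truncated_contour
             simp: complex_nonpos_Reals_iff divide_inverse simp flip: inverse_minus_eq\<close>)
    from contour_integral_unique[OF this]
    have ci: "contour_integral (truncated_contour (vline c) X) (\<lambda>w. 1 / (w - p)) =
       - (Ln ((p - of_real c) + \<i> * of_real X) - Ln ((p - of_real c) - \<i> * of_real X))" for X
      by (simp add: Complex_eq algebra_simps)
    have eq: "winding_number (truncated_contour (vline c) X) p =
       - (1 / (2 * pi * \<i>) * (Ln ((p - of_real c) + \<i> * of_real X) - Ln ((p - of_real c) - \<i> * of_real X)))" for X
      using p by (simp only: wn ci mult_minus_right)
    have "((\<lambda>X. winding_number (truncated_contour (vline c) X) p) \<longlongrightarrow> - (1 / (2 * pi * \<i>) * (\<i> * pi))) at_top"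
      unfolding eq using p by (intro tendsto_intros Ln_vertical_tendsto) auto
    then show ?thesis using off p by (simp add: contour_index_def del: truncated_contour_simps)
  qed
qed

lemma contour_separates_vline:
  assumes "\<And>p. p \<in> A \<Longrightarrow> Re p < c" "\<And>p. p \<in> B \<Longrightarrow> Re p > c"
  shows "contour_separates (vline c) A B"
  unfolding contour_separates_def using assms contour_index_vline by auto

section \<open>Absolute convergence along vertical lines\<close>

lemma integrable_quadratic_decay:
  fixes g :: "real \<Rightarrow> 'a :: {banach, second_countable_topology}"
  assumes cont: "continuous_on UNIV g" and dec: "\<And>t. \<bar>t\<bar> \<ge> Y \<Longrightarrow> norm (g t) * \<bar>t\<bar> ^ 2 \<le> C"
  shows "integrable lborel g"
proof -
  define Z where "Z = max Y 1"
  have "compact (g ` {-Z..Z})"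
    by (intro compact_continuous_image continuous_on_subset[OF cont]) auto
  then obtain B where "\<forall>y\<in>g ` {-Z..Z}. norm y \<le> B"
    using compact_imp_bounded bounded_iff by metis
  then have B: "norm (g t) \<le> B" if "\<bar>t\<bar> \<le> Z" for t
    using that by (simp add: abs_le_iff)
  \<comment> \<open>The majorant is K / (1 + t^2): the first entry covers the compact part, the
    second the rest, where 1 + t^2 \<le> 2 t^2 because Z \<ge> 1.\<close>
  define K where "K = max (B * (1 + Z^2)) (2 * C)"
  have bound: "norm (g t) \<le> norm (K * inverse (1 + t^2))" for t
  proof -
    have "norm (g t) * (1 + t^2) \<le> K"
    proof (cases "\<bar>t\<bar> \<le> Z")
      case True
      then have "t^2 \<le> Z^2" by (simp add: abs_le_square_iff[symmetric] Z_def)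
      then have "norm (g t) * (1 + t^2) \<le> B * (1 + Z^2)"
        using B[OF True] norm_ge_zero[of "g t"]
        by (intro mult_mono) (linarith | simp add: add_nonneg_nonneg)+
      then show ?thesis by (simp add: K_def)
    next
      case False
      then have "\<bar>t\<bar> \<ge> 1" "\<bar>t\<bar> \<ge> Y" by (auto simp: Z_def)
      then have "1 + t^2 \<le> 2 * t^2" by (simp add: abs_le_square_iff[of 1 t, simplified])
      then have "norm (g t) * (1 + t^2) \<le> norm (g t) * (2 * t^2)" by (rule mult_left_mono) auto
      also have "\<dots> \<le> 2 * C" using dec[OF \<open>\<bar>t\<bar> \<ge> Y\<close>] by simp
      finally show ?thesis by (simp add: K_def)
    qed
    moreover have "1 + t^2 > 0" by (simp add: add_pos_nonneg)
    ultimately have "norm (g t) \<le> K * inverse (1 + t^2)" by (simp add: field_simps)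
    then show ?thesis using abs_ge_self[of "K * inverse (1 + t^2)"] unfolding real_norm_def by linarith
  qed
  have "integrable lborel (\<lambda>t::real. inverse (1 + t^2))"
    using integrable_inverse_1_plus_square by (simp add: set_integrable_def einterval_def)
  then have "integrable lborel (\<lambda>t::real. K * inverse (1 + t^2))" by simp
  moreover have "g \<in> borel_measurable lborel"
    using cont by (simp add: borel_measurable_continuous_onI)
  ultimately show ?thesis
    by (rule Bochner_Integration.integrable_bound) (intro AE_I2 bound)
qed

lemma integrable_vertical_line:
  assumes "continuous_on {s. Re s = c} f" "strip_decay 2 f"
  shows "integrable lborel (\<lambda>t. f (Complex c t))"
proof -
  obtain C Y where C: "\<And>s. \<bar>Re s\<bar> \<le> \<bar>c\<bar> \<Longrightarrow> \<bar>Im s\<bar> \<ge> Y \<Longrightarrow> norm (f s) * \<bar>Im s\<bar> ^ 2 \<le> C"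
    by (rule strip_decayE[OF assms(2), where R = "\<bar>c\<bar>"], rule that)
  show ?thesis
  proof (rule integrable_quadratic_decay)
    show "continuous_on UNIV (\<lambda>t. f (Complex c t))"
      by (rule continuous_on_compose2[OF assms(1)]) (auto intro!: continuous_intros simp: Complex_eq)
    show "norm (f (Complex c t)) * \<bar>t\<bar> ^ 2 \<le> C" if "\<bar>t\<bar> \<ge> Y" for t
      using C[of "Complex c t"] that by simp
  qed
qed

text \<open>Dominated convergence with majorant \<open>norm (g t)\<close>. It replaces the limit
  over truncations in the definition of the G-function by a Lebesgue integral, to which Fubini's
  theorem and substitutions apply.\<close>

lemma integral_symmetric_interval_tendsto:
  fixes g :: "real \<Rightarrow> 'a :: euclidean_space"
  assumes g: "integrable lborel g"
  shows "((\<lambda>X. integral {-X..X} g) \<longlongrightarrow> (LINT t|lborel. g t)) at_top"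
proof -
  have "((\<lambda>X. LINT t|lborel. indicator {-X..X} t *\<^sub>R g t) \<longlongrightarrow> (LINT t|lborel. g t)) at_top"
  proof (rule integral_dominated_convergence_at_top)
    show "integrable lborel (\<lambda>t. norm (g t))" using g by simp
    show "\<forall>\<^sub>F X in at_top. AE t in lborel. norm (indicator {-X..X} t *\<^sub>R g t) \<le> norm (g t)"
      by (auto simp: indicator_def)
    show "AE t in lborel. ((\<lambda>X. indicator {-X..X} t *\<^sub>R g t) \<longlongrightarrow> g t) at_top"
    proof (intro AE_I2 tendsto_eventually)
      fix t :: real
      show "\<forall>\<^sub>F X in at_top. indicator {-X..X} t *\<^sub>R g t = g t"
        using eventually_ge_at_top[of "\<bar>t\<bar>"] by eventually_elim (auto simp: indicator_def)
    qed
  qed (use g in auto)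
  moreover have "(LINT t|lborel. indicator {-X..X} t *\<^sub>R g t) = integral {-X..X} g" for X
  proof -
    have "set_integrable lborel {-X..X} g"
      using g unfolding set_integrable_def by (intro integrable_mult_indicator) auto
    from set_borel_integral_eq_integral(2)[OF this] show ?thesis by (simp add: set_lebesgue_integral_def)
  qed
  ultimately show ?thesis by simp
qed

section \<open>G-functions as integrals along vertical lines\<close>

text \<open>The unit ball about a limit point would contain infinitely many points of
  \<open>P\<close>, yet it lies in a vertical strip.\<close>

lemma closed_if_finite_in_strips:
  assumes "\<And>R. finite {p \<in> P. \<bar>Re p\<bar> \<le> R}"
  shows "closed P"
proof -
  have False if "x islimpt P" for x
  proof -
    have "infinite (P \<inter> ball x 1)" using that by (simp add: islimpt_eq_infinite_ball)
    moreover have "P \<inter> ball x 1 \<subseteq> {p \<in> P. \<bar>Re p\<bar> \<le> \<bar>Re x\<bar> + 1}"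
    proof clarsimp
      fix p assume "dist x p < 1"
      then show "\<bar>Re p\<bar> \<le> \<bar>Re x\<bar> + 1"
        using abs_Re_le_cmod[of "x - p"] by (simp add: dist_norm)
    qed
    ultimately show False using assms finite_subset by blast
  qed
  then show ?thesis by (auto simp: closed_limpt)
qed

lemma finite_meijer_G_poles_in_strip:
  "finite {p \<in> meijer_G_left_poles m b \<union> meijer_G_right_poles n a. \<bar>Re p\<bar> \<le> R}"
proof -
  have fin: "finite {k. real k \<le> x}" for x
    by (rule finite_subset[of _ "{..nat \<lfloor>x\<rfloor>}"]) (auto simp: le_nat_floor)
  have "{p \<in> meijer_G_left_poles m b \<union> meijer_G_right_poles n a. \<bar>Re p\<bar> \<le> R} \<subseteq>
     (\<Union>i<m. (\<lambda>k. - (b ! i) - of_nat k) ` {k. real k \<le> R + \<bar>Re (b ! i)\<bar>}) \<union>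
     (\<Union>i<n. (\<lambda>k. 1 - a ! i + of_nat k) ` {k. real k \<le> R + \<bar>Re (1 - a ! i)\<bar>})"
    by (fastforce simp: meijer_G_left_poles_def meijer_G_right_poles_def)
  then show ?thesis by (rule finite_subset) (auto intro!: fin)
qed

lemma holomorphic_meijer_G_integrand:
  assumes "z \<noteq> 0"
  shows "meijer_G_integrand m n a b z holomorphic_on
           - (meijer_G_left_poles m b \<union> meijer_G_right_poles n a)"
proof -
  define S where "S = - (meijer_G_left_poles m b \<union> meijer_G_right_poles n a)"
  have "b ! i + s \<notin> \<int>\<^sub>\<le>\<^sub>0" if "i < m" "s \<in> S" for i s
  proof
    assume "b ! i + s \<in> \<int>\<^sub>\<le>\<^sub>0"
    then obtain k where "b ! i + s = - of_nat k" by (elim nonpos_Ints_cases')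
    then have "s = - (b ! i) - of_nat k" by (simp add: algebra_simps eq_neg_iff_add_eq_0)
    with that show False by (auto simp: S_def meijer_G_left_poles_def)
  qed
  moreover have "1 - a ! i - s \<notin> \<int>\<^sub>\<le>\<^sub>0" if "i < n" "s \<in> S" for i s
  proof
    assume "1 - a ! i - s \<in> \<int>\<^sub>\<le>\<^sub>0"
    then obtain k where "1 - a ! i - s = - of_nat k" by (elim nonpos_Ints_cases')
    then have "s = 1 - a ! i + of_nat k" by (simp add: algebra_simps)
    with that show False by (auto simp: S_def meijer_G_right_poles_def)
  qed
  \<comment> \<open>With the entire function \<open>rGamma\<close> for the denominators, only the
    numerators restrict the domain.\<close>
  ultimately have "(\<lambda>s. (\<Prod>i<m. Gamma (b ! i + s)) * (\<Prod>i<n. Gamma (1 - a ! i - s)) *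
     ((\<Prod>i=n..<length a. rGamma (a ! i + s)) * (\<Prod>i=m..<length b. rGamma (1 - b ! i - s)))
     * z powr (- s)) holomorphic_on S"
    using assms by (intro holomorphic_intros) auto
  also have "?this \<longleftrightarrow> meijer_G_integrand m n a b z holomorphic_on S"
    by (intro holomorphic_cong)
       (auto simp: meijer_G_integrand_def rGamma_inverse_Gamma prod_inversef[symmetric] divide_inverse)
  finally show ?thesis by (simp add: S_def)
qed

text \<open>The line is one separating contour, and every other one gives a truncated integral with
  the same limit, so the definite description is determined. On the line ds = i dt, which reduces
  the factor 1 / (2 pi i) to 1 / (2 pi).\<close>

lemma meijer_G_eq_vertical_integral:
  assumes "z \<noteq> 0"
    and left: "\<And>p. p \<in> meijer_G_left_poles m b \<Longrightarrow> Re p < c"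
    and right: "\<And>p. p \<in> meijer_G_right_poles n a \<Longrightarrow> Re p > c"
    and dec: "strip_decay 2 (meijer_G_integrand m n a b z)"
  shows "integrable lborel (\<lambda>t. meijer_G_integrand m n a b z (Complex c t))" (is ?int)
    and "meijer_G m n a b z =
           1 / (2 * pi) * (LINT t|lborel. meijer_G_integrand m n a b z (Complex c t))" (is ?eq)
proof -
  define A where "A = meijer_G_left_poles m b"
  define B where "B = meijer_G_right_poles n a"
  define f where "f = meijer_G_integrand m n a b z"
  have holo: "f holomorphic_on - (A \<union> B)"
    using holomorphic_meijer_G_integrand[OF assms(1)] by (simp add: f_def A_def B_def)
  have "{s. Re s = c} \<subseteq> - (A \<union> B)"
    using left right by (force simp: A_def B_def)
  then have cont: "continuous_on {s. Re s = c} f"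
    using holo holomorphic_on_imp_continuous_on continuous_on_subset by blast
  then show ?int using integrable_vertical_line dec by (simp add: f_def)
  then have int: "integrable lborel (\<lambda>t. f (Complex c t))" by (simp add: f_def)
  have sep: "contour_separates (vline c) A B"
    using left right by (intro contour_separates_vline) (auto simp: A_def B_def)
  have "((\<lambda>X. \<i> * integral {-X..X} (\<lambda>t. f (Complex c t))) \<longlongrightarrow> \<i> * (LINT t|lborel. f (Complex c t))) at_top"
    by (intro tendsto_intros integral_symmetric_interval_tendsto int)
  moreover have "\<forall>\<^sub>F X in at_top. \<i> * integral {-X..X} (\<lambda>t. f (Complex c t)) =
      contour_integral (truncated_contour (vline c) X) f"
    using eventually_gt_at_top[of 0] by eventually_elim (simp add: contour_integral_truncated_vline cont)
  ultimately have lim: "((\<lambda>X. contour_integral (truncated_contour (vline c) X) f) \<longlongrightarrow>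
      \<i> * (LINT t|lborel. f (Complex c t))) at_top"
    by (rule Lim_transform_eventually)
  define I where "I = 1 / (2 * pi) * (LINT t|lborel. f (Complex c t))"
  have I: "I = 1 / (2 * of_real pi * \<i>) * (\<i> * (LINT t|lborel. f (Complex c t)))"
    by (simp add: I_def)
  have limI: "((\<lambda>X. 1 / (2 * of_real pi * \<i>) * contour_integral (truncated_contour (vline c) X) f) \<longlongrightarrow> I) at_top"
    unfolding I by (intro tendsto_intros lim)
  have "J = I" if g: "contour_separates g A B" and
      J: "((\<lambda>X. 1 / (2 * of_real pi * \<i>) * contour_integral (truncated_contour g X) f) \<longlongrightarrow> J) at_top" for g J
  proof -
    have "((\<lambda>X. contour_integral (truncated_contour g X) f - contour_integral (truncated_contour (vline c) X) f) \<longlongrightarrow> 0) at_top"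
      using holo g sep dec finite_meijer_G_poles_in_strip strip_decay_mono[of 2 f 1]
      by (intro contour_difference_tendsto_0[of A B] closed_if_finite_in_strips) (auto simp: A_def B_def f_def)
    then have "((\<lambda>X. 1 / (2 * of_real pi * \<i>) * (contour_integral (truncated_contour g X) f - contour_integral (truncated_contour (vline c) X) f))
         \<longlongrightarrow> 1 / (2 * of_real pi * \<i>) * 0) at_top"
      by (intro tendsto_intros)
    from tendsto_add[OF this limI]
    have "((\<lambda>X. 1 / (2 * of_real pi * \<i>) * contour_integral (truncated_contour g X) f) \<longlongrightarrow> I) at_top"
      by (simp add: diff_divide_distrib)
    with J show ?thesis by (intro tendsto_unique[of at_top]) auto
  qed
  then have "meijer_G m n a b z = I"
    using sep limI unfolding meijer_G_def A_def[symmetric] B_def[symmetric] f_def[symmetric]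
    by (intro the_equality) blast+
  then show ?eq by (simp add: I_def f_def)
qed

section \<open>Decay of the Gamma function in vertical strips\<close>

lemma strip_decay_shift:
  assumes "strip_decay N f"
  shows "strip_decay N (\<lambda>s. f (a + s))"
proof (rule strip_decayI)
  fix R :: real
  obtain C Y where C: "C > 0" "Y > 0"
    "\<And>s. \<bar>Re s\<bar> \<le> R + \<bar>Re a\<bar> \<Longrightarrow> \<bar>Im s\<bar> \<ge> Y \<Longrightarrow> norm (f s) * \<bar>Im s\<bar> ^ N \<le> C"
    by (rule strip_decayE[OF assms, where R = "R + \<bar>Re a\<bar>"], rule that)
  show "\<exists>C Y. \<forall>s. \<bar>Re s\<bar> \<le> R \<longrightarrow> \<bar>Im s\<bar> \<ge> Y \<longrightarrow> norm (f (a + s)) * \<bar>Im s\<bar> ^ N \<le> C"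
  proof (intro exI allI impI)
    \<comment> \<open>This height leaves \<open>\<bar>Im (a + s)\<bar>\<close> at least
      \<open>Y\<close> and at least half of \<open>\<bar>Im s\<bar>\<close>; the half costs the
      factor 2 ^ N.\<close>
    fix s assume s: "\<bar>Re s\<bar> \<le> R" "2 * \<bar>Im a\<bar> + 2 * Y \<le> \<bar>Im s\<bar>"
    have "x \<le> 2 * z \<and> Y \<le> z" if "2 * y + 2 * Y \<le> x" "x - y \<le> z" "0 \<le> y" for x y z :: real
      using that \<open>Y > 0\<close> by linarith
    from this[OF s(2), of "\<bar>Im s + Im a\<bar>"]
    have im: "\<bar>Im s\<bar> \<le> 2 * \<bar>Im (a + s)\<bar>" "Y \<le> \<bar>Im (a + s)\<bar>"
      using abs_triangle_ineq2[of "Im s" "- Im a"] by (auto simp: add.commute)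
    have "norm (f (a + s)) * \<bar>Im s\<bar> ^ N \<le> norm (f (a + s)) * (2 * \<bar>Im (a + s)\<bar>) ^ N"
      using im by (intro mult_left_mono power_mono) auto
    also have "\<dots> = 2 ^ N * (norm (f (a + s)) * \<bar>Im (a + s)\<bar> ^ N)"
      by (simp add: power_mult_distrib)
    also have "\<dots> \<le> 2 ^ N * C"
      using im(2) s(1) abs_triangle_ineq[of "Re a" "Re s"] by (intro mult_left_mono C(3)) auto
    finally show "norm (f (a + s)) * \<bar>Im s\<bar> ^ N \<le> 2 ^ N * C" .
  qed
qed

lemma strip_decay_uminus:
  assumes "strip_decay N f"
  shows "strip_decay N (\<lambda>s. f (- s))"
proof (rule strip_decayI)
  fix R :: real
  obtain C Y where C: "C > 0" "Y > 0"
    "\<And>s. \<bar>Re s\<bar> \<le> R \<Longrightarrow> \<bar>Im s\<bar> \<ge> Y \<Longrightarrow> norm (f s) * \<bar>Im s\<bar> ^ N \<le> C"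
    by (rule strip_decayE[OF assms, where R = R], rule that)
  show "\<exists>C Y. \<forall>s. \<bar>Re s\<bar> \<le> R \<longrightarrow> \<bar>Im s\<bar> \<ge> Y \<longrightarrow> norm (f (- s)) * \<bar>Im s\<bar> ^ N \<le> C"
    using C(3)[of "- s" for s] by (intro exI[of _ C] exI[of _ Y]) auto
qed

text \<open>Triangle inequality in Euler's integral, as t powr (s - 1) has modulus t powr (Re s -
  1).\<close>

lemma norm_Gamma_le:
  assumes "Re s > 0"
  shows "norm (Gamma s) \<le> Gamma (Re s)"
proof -
  have "norm (integral {0..} (\<lambda>t. of_real t powr (s - 1) / of_real (exp t))) \<le> integral {0..} (\<lambda>t. t powr (Re s - 1) / exp t)"
  proof (rule integral_norm_bound_integral)
    show "(\<lambda>t. complex_of_real t powr (s - 1) / of_real (exp t)) integrable_on {0..}"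
      using Gamma_integral_complex[OF assms] by blast
    show "(\<lambda>t. t powr (Re s - 1) / exp t) integrable_on {0..}"
      using Gamma_integral_real[OF assms] by blast
    show "norm (complex_of_real t powr (s - 1) / of_real (exp t)) \<le> t powr (Re s - 1) / exp t" if "t \<in> {0..}" for t
      using that by (auto simp: norm_divide norm_powr_real_powr)
  qed
  then show ?thesis
    using integral_unique[OF Gamma_integral_complex[OF assms]] integral_unique[OF Gamma_integral_real[OF assms]]
    by simp
qed

text \<open>
  The functional equation trades \<open>k\<close> powers of \<open>\<bar>Im s\<bar>\<close> for a shift by \<open>k\<close> to the right, where Gamma
  is bounded; no Stirling estimate is needed.
\<close>

lemma strip_decay_Gamma: "strip_decay N Gamma"
proof (rule strip_decayI)
  fix R :: real assume R: "R > 0"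
  \<comment> \<open>The first bound moves the real part into the compact interval from 1 to k + R.
    The second supplies at least N Pochhammer factors s + i, each of modulus at least
    \<open>\<bar>Im s\<bar>\<close>.\<close>
  obtain k where k: "real k \<ge> R + 1" "k \<ge> N"
    by (metis real_nat_ceiling_ge max.cobounded1 max.cobounded2 of_nat_le_iff order_trans)
  have "compact (Gamma ` {1..real k + R})"
    by (intro compact_continuous_image continuous_intros) (auto elim!: nonpos_Ints_cases)
  then obtain C where C: "\<And>x. x \<in> {1..real k + R} \<Longrightarrow> norm (Gamma x) \<le> C"
    using compact_imp_bounded bounded_iff by (metis imageI)
  show "\<exists>C Y. \<forall>s. \<bar>Re s\<bar> \<le> R \<longrightarrow> \<bar>Im s\<bar> \<ge> Y \<longrightarrow> norm (Gamma s) * \<bar>Im s\<bar> ^ N \<le> C"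
  proof (rule exI[of _ C], rule exI[of _ 1], intro allI impI)
    fix s assume s: "\<bar>Re s\<bar> \<le> R" "1 \<le> \<bar>Im s\<bar>"
    have ns: "s \<notin> \<int>\<^sub>\<le>\<^sub>0" using s by (auto elim!: nonpos_Ints_cases)
    have "\<bar>Im s\<bar> ^ N \<le> \<bar>Im s\<bar> ^ k" using s k by (intro power_increasing) auto
    also have "\<dots> = (\<Prod>i<k. \<bar>Im (s + of_nat i)\<bar>)" by simp
    also have "\<dots> \<le> (\<Prod>i<k. norm (s + of_nat i))"
      by (intro prod_mono conjI abs_Im_le_cmod) auto
    also have "\<dots> = norm (pochhammer s k)"
      by (simp add: pochhammer_prod prod_norm atLeast0LessThan)
    finally have "norm (Gamma s) * \<bar>Im s\<bar> ^ N \<le> norm (Gamma s) * norm (pochhammer s k)"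
      by (rule mult_left_mono) auto
    also have "\<dots> = norm (Gamma (s + of_nat k))"
      using pochhammer_Gamma[OF ns, of k] Gamma_eq_zero_iff[of s] ns by (simp add: norm_mult[symmetric])
    also have "\<dots> \<le> Gamma (Re (s + of_nat k))"
      using s k by (intro norm_Gamma_le) auto
    also have "\<dots> \<le> norm (Gamma (Re (s + of_nat k)))" by simp
    also have "\<dots> \<le> C" using s k by (intro C) auto
    finally show "norm (Gamma s) * \<bar>Im s\<bar> ^ N \<le> C" .
  qed
qed

lemma strip_decay_Gamma_shift:
  "strip_decay N (\<lambda>s. Gamma (a + s))" "strip_decay N (\<lambda>s. Gamma (a - s))"
  using strip_decay_shift[OF strip_decay_Gamma]
        strip_decay_uminus[OF strip_decay_shift[OF strip_decay_Gamma]] by auto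

text \<open>For positive z the modulus is z powr (- Re s), which does not involve the height at
  all.\<close>

lemma strip_decay_powr:
  assumes "z > 0"
  shows "strip_decay 0 (\<lambda>s. of_real z powr (- s))"
proof (rule strip_decayI)
  fix R :: real assume "R > 0"
  have "z powr (- x) \<le> exp (R * \<bar>ln z\<bar>)" if "\<bar>x\<bar> \<le> R" for x
  proof -
    have "- x * ln z \<le> \<bar>x\<bar> * \<bar>ln z\<bar>" by (metis abs_ge_self abs_minus_cancel abs_mult)
    also have "\<dots> \<le> R * \<bar>ln z\<bar>" using that by (intro mult_right_mono) auto
    finally show ?thesis using assms by (simp add: powr_def)
  qed
  then show "\<exists>C Y. \<forall>s. \<bar>Re s\<bar> \<le> R \<longrightarrow> \<bar>Im s\<bar> \<ge> Y \<longrightarrow> norm (of_real z powr (- s)) * \<bar>Im s\<bar> ^ 0 \<le> C"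
    using assms by (intro exI[of _ "exp (R * \<bar>ln z\<bar>)"] exI[of _ 0]) (auto simp: norm_powr_real_powr)
qed

section \<open>The Cahen--Mellin integral\<close>

lemma contour_integral_rectpath:
  assumes "continuous_on (path_image (rectpath a b)) f" "Re a < Re b" "Im a < Im b"
  shows "contour_integral (rectpath a b) f =
     contour_integral (linepath a (Complex (Re b) (Im a))) f +
     \<i> * integral {Im a..Im b} (\<lambda>t. f (Complex (Re b) t)) -
     contour_integral (linepath (Complex (Re a) (Im b)) b) f -
     \<i> * integral {Im a..Im b} (\<lambda>t. f (Complex (Re a) t))"
proof -
  define a2 a4 where "a2 = Complex (Re b) (Im a)" and "a4 = Complex (Re a) (Im b)"
  have rp: "rectpath a b = linepath a a2 +++ linepath a2 b +++ linepath b a4 +++ linepath a4 a"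
    by (simp add: rectpath_def Let_def a2_def a4_def)
  have cont: "continuous_on (closed_segment p q) f" if "(p, q) \<in> {(a, a2), (a2, b), (b, a4), (a4, a)}" for p q
    using that unfolding rp by (intro continuous_on_subset[OF assms(1)]) (auto simp: rp path_image_join)
  then have int: "f contour_integrable_on linepath p q" if "(p, q) \<in> {(a, a2), (a2, b), (b, a4), (a4, a)}" for p q
    using that by (intro contour_integrable_continuous_linepath) auto
  have "contour_integral (rectpath a b) f = contour_integral (linepath a a2) f +
     (contour_integral (linepath a2 b) f + (contour_integral (linepath b a4) f + contour_integral (linepath a4 a) f))"
    unfolding rp by (simp add: int contour_integrable_join valid_path_join)
  also have "contour_integral (linepath b a4) f = - contour_integral (linepath a4 b) f"
    by (rule contour_integral_reverse_linepath) (auto intro!: cont)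
  also have "contour_integral (linepath a4 a) f = - contour_integral (linepath a a4) f"
    by (rule contour_integral_reverse_linepath) (auto intro!: cont)
  also have "contour_integral (linepath a2 b) f = \<i> * integral {Im a..Im b} (\<lambda>t. f (Complex (Re b) t))"
    using assms by (intro contour_integral_linepath_same_Re) (auto simp: a2_def)
  also have "contour_integral (linepath a a4) f = \<i> * integral {Im a..Im b} (\<lambda>t. f (Complex (Re a) t))"
    using assms by (intro contour_integral_linepath_same_Re) (auto simp: a4_def)
  finally show ?thesis by (simp add: a2_def a4_def)
qed

text \<open>Residue theorem on the rectangle with corners c - i X and d + i X. Its horizontal sides
  vanish as X grows, and the strip between the lines contains finitely many poles.\<close>

lemma vertical_line_shift:
  assumes fin: "\<And>R. finite {p \<in> P. \<bar>Re p\<bar> \<le> R}" and holo: "f holomorphic_on - P"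
    and dec: "strip_decay 2 f" and "c < d"
    and off: "\<And>p. p \<in> P \<Longrightarrow> Re p \<noteq> c \<and> Re p \<noteq> d"
  shows "(LINT t|lborel. f (Complex d t)) - (LINT t|lborel. f (Complex c t)) =
           2 * pi * (\<Sum>p\<in>{p \<in> P. c < Re p \<and> Re p < d}. residue f p)"
proof -
  define Q where "Q = {p \<in> P. c < Re p \<and> Re p < d}"
  have finQ: "finite Q"
    by (rule finite_subset[OF _ fin[of "max \<bar>c\<bar> \<bar>d\<bar>"]]) (auto simp: Q_def)
  \<comment> \<open>The residue theorem wants a connected domain: the plane without the poles
    outside the strip, which are countably many.\<close>
  have "P \<subseteq> (\<Union>n. {p \<in> P. \<bar>Re p\<bar> \<le> real n})"
    using real_arch_simple by auto
  then have "countable P"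
    by (rule countable_subset) (intro countable_UN countable_finite fin countableI_type)
  then have conn: "connected (- (P - Q))"
    by (intro path_connected_imp_connected path_connected_complement_countable) auto
  have "closed (P - Q)"
    by (rule closed_if_finite_in_strips) (auto intro: finite_subset[OF _ fin])
  then have opn: "open (- (P - Q))" by (rule open_Compl)
  have cont: "continuous_on (-P) f" using holo by (rule holomorphic_on_imp_continuous_on)
  have line: "integrable lborel (\<lambda>t. f (Complex x t))" if "x \<in> {c, d}" for x
    using off that by (intro integrable_vertical_line dec continuous_on_subset[OF cont]) auto
  define rect where "rect = (\<lambda>X. rectpath (Complex c (-X)) (Complex d X))"
  define H where "H = (\<lambda>X. contour_integral (linepath (Complex c X) (Complex d X)) f)"
  have H: "(H \<longlongrightarrow> 0) at_infinity"
    unfolding H_def by (rule horizontal_contour_integral_tendsto_0[OF cont fin strip_decay_mono[OF dec]]) auto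
  have top: "filterlim (\<lambda>X::real. X) at_infinity at_top"
    by (simp add: filterlim_def at_top_le_at_infinity)
  have bot: "filterlim (\<lambda>X::real. - X) at_infinity at_top"
    using filterlim_uminus_at_bot_at_top at_bot_le_at_infinity filterlim_mono by blast
  have ev: "\<forall>\<^sub>F X in at_top. H (-X) + \<i> * integral {-X..X} (\<lambda>t. f (Complex d t)) - H X
      - \<i> * integral {-X..X} (\<lambda>t. f (Complex c t)) = 2 * pi * \<i> * (\<Sum>p\<in>Q. residue f p)"
  proof -
    \<comment> \<open>From here on the rectangle encloses all of \<open>Q\<close>, so each of these
      poles has winding number 1.\<close>
    have "\<forall>\<^sub>F X in at_top. \<forall>p\<in>Q. \<bar>Im p\<bar> < X"
      by (intro eventually_ball_finite finQ ballI eventually_gt_at_top)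
    moreover have "\<forall>\<^sub>F X in at_top. closed_segment (Complex c X) (Complex d X) \<inter> P = {}"
      using eventually_compose_filterlim[OF eventually_closed_segment_disjoint[OF fin] top] by simp
    moreover have "\<forall>\<^sub>F X in at_top. closed_segment (Complex c (-X)) (Complex d (-X)) \<inter> P = {}"
      using eventually_compose_filterlim[OF eventually_closed_segment_disjoint[OF fin] bot] by simp
    ultimately show ?thesis using eventually_gt_at_top[of 0]
    proof eventually_elim
      case (elim X)
      have vert: "closed_segment p q \<inter> P = {}" if "Re p = x" "Re q = x" "x \<in> {c, d}" for p q x
        using closed_segment_same_Re[OF that(1,2)] off that(3) by blast
      have img: "path_image (rect X) \<subseteq> - P"
        using elim vert[of "Complex d (-X)" d "Complex d X"] vert[of "Complex c X" c "Complex c (-X)"]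
        by (auto simp: rect_def rectpath_def Let_def path_image_join closed_segment_commute)
      have "contour_integral (rect X) f = 2 * pi * \<i> * (\<Sum>p\<in>Q. winding_number (rect X) p * residue f p)"
      proof (rule Residue_theorem[OF opn conn finQ])
        show "f holomorphic_on - (P - Q) - Q"
          by (rule holomorphic_on_subset[OF holo]) (auto simp: Q_def)
        show "path_image (rect X) \<subseteq> - (P - Q) - Q" using img by (auto simp: Q_def)
        show "\<forall>p. p \<notin> - (P - Q) \<longrightarrow> winding_number (rect X) p = 0"
        proof (intro allI impI)
          fix p assume p: "p \<notin> - (P - Q)"
          then have "p \<notin> cbox (Complex c (-X)) (Complex d X)"
            using off[of p] by (auto simp: Q_def in_cbox_complex_iff)
          then show "winding_number (rect X) p = 0"
            unfolding rect_def using elim \<open>c < d\<close> by (intro winding_number_rectpath_outside) auto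
        qed
      qed (auto simp: rect_def)
      also have "(\<Sum>p\<in>Q. winding_number (rect X) p * residue f p) = (\<Sum>p\<in>Q. residue f p)"
        using elim by (intro sum.cong) (auto simp: rect_def Q_def in_box_complex_iff winding_number_rectpath abs_less_iff)
      finally show ?case
        using img cont elim \<open>c < d\<close> continuous_on_subset unfolding rect_def
        by (subst (asm) contour_integral_rectpath) (auto simp: H_def)
    qed
  qed
  have lim: "((\<lambda>X. H (-X) + \<i> * integral {-X..X} (\<lambda>t. f (Complex d t)) - H X
      - \<i> * integral {-X..X} (\<lambda>t. f (Complex c t))) \<longlongrightarrow>
      0 + \<i> * (LINT t|lborel. f (Complex d t)) - 0 - \<i> * (LINT t|lborel. f (Complex c t))) at_top"
    by (intro tendsto_intros integral_symmetric_interval_tendsto line filterlim_compose[OF H top]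
        filterlim_compose[OF H bot]) auto
  have "\<i> * (LINT t|lborel. f (Complex d t)) - \<i> * (LINT t|lborel. f (Complex c t)) =
      2 * pi * \<i> * (\<Sum>p\<in>Q. residue f p)"
    using tendsto_unique[OF _ lim tendsto_eventually[OF ev]] by simp
  then have "\<i> * ((LINT t|lborel. f (Complex d t)) - (LINT t|lborel. f (Complex c t))) =
      \<i> * (2 * pi * (\<Sum>p\<in>Q. residue f p))"
    by (simp add: algebra_simps)
  then show ?thesis by (simp add: Q_def)
qed

section \<open>The exponential function as a residue series\<close>

lemma of_nat_neq_of_nat_plus_half: "real k \<noteq> real n + 1/2"
proof
  assume "real k = real n + 1/2"
  then have "real_of_int (2 * (int k - int n)) = real_of_int 1" by simp
  then have "2 * (int k - int n) = 1" by (simp only: of_int_eq_iff)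
  then show False by presburger
qed

text \<open>Dividing Gamma at s + n + 1, which lies on Re = 1/2, by the Pochhammer product gives
  Gamma at s. The factor s + j has real part of modulus n - j + 1/2, at least n - j for j < n and
  equal to 1/2 for j = n, so the product is at least n! / 2. This factorial makes the remainder
  vanish in the Cahen--Mellin integral.\<close>

lemma norm_Gamma_left_half_plane_le:
  "norm (Gamma (Complex (- real n - 1/2) t)) \<le> 2 / fact n * norm (Gamma (Complex (1/2) t))"
proof -
  define s where "s = Complex (- real n - 1/2) t"
  have ns: "s \<notin> \<int>\<^sub>\<le>\<^sub>0"
  proof
    assume "s \<in> \<int>\<^sub>\<le>\<^sub>0"
    then obtain k where "s = - of_nat k" by (elim nonpos_Ints_cases')
    then have "Re s = - real k" by simp
    then show False using of_nat_neq_of_nat_plus_half[of k n] by (simp add: s_def)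
  qed
  have le: "(if j < n then real (n - j) else 1/2) \<le> norm (s + of_nat j)" if "j \<le> n" for j
  proof -
    have "(if j < n then real (n - j) else 1/2) \<le> \<bar>Re (s + of_nat j)\<bar>"
      using that by (auto simp: s_def of_nat_diff)
    also have "\<dots> \<le> norm (s + of_nat j)" by (rule abs_Re_le_cmod)
    finally show ?thesis .
  qed
  have "fact n / 2 = (\<Prod>j<Suc n. if j < n then real (n - j) else 1/2)"
    by (simp add: fact_prod_rev atLeast0LessThan)
  also have "\<dots> \<le> (\<Prod>j<Suc n. norm (s + of_nat j))"
    using le by (intro prod_mono) auto
  also have "\<dots> = norm (pochhammer s (Suc n))"
    unfolding pochhammer_prod prod_norm atLeast0LessThan ..
  also have "pochhammer s (Suc n) = Gamma (Complex (1/2) t) / Gamma s"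
    using pochhammer_Gamma[OF ns, of "Suc n"] by (simp add: s_def Complex_eq add_ac)
  finally have "fact n / 2 * norm (Gamma s) \<le> norm (Gamma (Complex (1/2) t))"
    using ns by (simp add: norm_divide pos_le_divide_eq Gamma_eq_zero_iff)
  then show ?thesis by (simp add: s_def field_simps)
qed

text \<open>Gamma has residue (-1)^n / n! there, and the power contributes z^n: together the n-th
  term of the series of exp (- z).\<close>

lemma residue_Gamma_powr:
  assumes "z > 0"
  shows "residue (\<lambda>s. Gamma s * of_real z powr (- s)) (- of_nat n) = of_real ((- z) ^ n / fact n)"
proof (rule residue_simple')
  show "open (- (\<int>\<^sub>\<le>\<^sub>0 - {-of_nat n}) :: complex set)"
    by (intro open_Compl closed_subset_Ints) auto
  show "(\<lambda>s. Gamma s * of_real z powr (- s)) holomorphic_on (- (\<int>\<^sub>\<le>\<^sub>0 - {-of_nat n}) - {- of_nat n})"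
    using assms by (intro holomorphic_intros) auto
  have "((\<lambda>w. Gamma w * (w - (-of_nat n)) * of_real z powr (- w)) \<longlongrightarrow>
      (- 1) ^ n / fact n * of_real z powr (- (- of_nat n))) (at (- of_nat n :: complex))"
    using Gamma_residues[of n] assms by (intro tendsto_intros) auto
  also have "of_real z powr (- (- of_nat n)) = complex_of_real z ^ n"
    using assms by (simp add: powr_nat)
  finally show "(\<lambda>w. Gamma w * complex_of_real z powr (- w) * (w - - of_nat n)) \<midarrow>- of_nat n\<rightarrow> of_real ((- z) ^ n / fact n)"
    by (simp add: mult_ac power_minus[of "complex_of_real z"])
qed auto

text \<open>Moving the line from Re s = 1 to Re s = - n - 1/2, halfway between two poles, collects a
  Taylor polynomial of exp (- z). The integral left over is at most a constant times z^n / n!, so it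
  tends to 0.\<close>

lemma Cahen_Mellin:
  assumes "z > 0"
  shows "(LINT t|lborel. Gamma (Complex 1 t) * of_real z powr (- Complex 1 t)) = 2 * pi * exp (- z)"
proof -
  define f where "f = (\<lambda>s. Gamma s * complex_of_real z powr (- s))"
  define P :: "complex set" where "P = \<int>\<^sub>\<le>\<^sub>0"
  have P: "P = range (\<lambda>k. - of_nat k)"
    by (auto simp: P_def elim!: nonpos_Ints_cases')
  have fin: "finite {p \<in> P. \<bar>Re p\<bar> \<le> R}" for R
  proof -
    have "{p \<in> P. \<bar>Re p\<bar> \<le> R} \<subseteq> (\<lambda>k. - of_nat k) ` {..nat \<lfloor>R\<rfloor>}"
      by (auto simp: P le_nat_floor)
    then show ?thesis by (rule finite_subset) auto
  qed
  have holo: "f holomorphic_on - P"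
    unfolding f_def P_def using assms by (intro holomorphic_intros) auto
  have dec: "strip_decay 2 f"
    using strip_decay_mult[OF strip_decay_Gamma[of 2] strip_decay_powr[OF assms]] by (simp add: f_def)
  \<comment> \<open>All remainders are compared with this one line, so K does not depend on
    n.\<close>
  define K where "K = (LINT t|lborel. norm (Gamma (Complex (1/2) t)))"
  have shift: "(LINT t|lborel. f (Complex 1 t)) - (LINT t|lborel. f (Complex (- real n - 1/2) t)) =
       complex_of_real (2 * pi * (\<Sum>k\<le>n. (- z) ^ k / fact k))" for n
  proof -
    have "{p \<in> P. - real n - 1/2 < Re p \<and> Re p < 1} = (\<lambda>k. - of_nat k) ` {..n}"
      by (auto simp: P)
    moreover have "- real k \<noteq> - real n - 1/2" for k
      using of_nat_neq_of_nat_plus_half[of k n] by simp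
    then have "\<And>p. p \<in> P \<Longrightarrow> Re p \<noteq> - real n - 1/2 \<and> Re p \<noteq> 1"
      by (auto simp: P)
    ultimately show ?thesis
      using vertical_line_shift[OF fin holo dec, of "- real n - 1/2" 1] residue_Gamma_powr[OF assms]
      by (simp add: sum.reindex inj_on_def f_def)
  qed
  have rem: "norm (LINT t|lborel. f (Complex (- real n - 1/2) t)) \<le> z powr (1/2) * 2 * K * (z ^ n / fact n)" for n
  proof -
    have int: "integrable lborel (\<lambda>t. norm (Gamma (Complex (1/2) t)))"
      by (intro integrable_norm integrable_vertical_line strip_decay_Gamma continuous_intros)
         (auto elim!: nonpos_Ints_cases)
    have "norm (LINT t|lborel. f (Complex (- real n - 1/2) t)) \<le>
        (LINT t|lborel. z powr (1/2) * 2 * (z ^ n / fact n) * norm (Gamma (Complex (1/2) t)))"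
    proof (rule order_trans[OF integral_norm_bound integral_mono[OF integrable_norm]])
      show "integrable lborel (\<lambda>t. f (Complex (- real n - 1/2) t))"
      proof (rule integrable_vertical_line[OF continuous_on_subset dec])
        show "continuous_on (- P) f" using holo by (rule holomorphic_on_imp_continuous_on)
        show "{s. Re s = - real n - 1/2} \<subseteq> - P"
        proof clarsimp
          fix s assume s: "Re s = - real n - 1/2" "s \<in> P"
          then obtain k where "- real k = - real n - 1/2" by (auto simp: P)
          then show False using of_nat_neq_of_nat_plus_half[of k n] by simp
        qed
      qed
      show "integrable lborel (\<lambda>t. z powr (1/2) * 2 * (z ^ n / fact n) * norm (Gamma (Complex (1/2) t)))"
        using int by simp
      fix t :: real
      have "norm (f (Complex (- real n - 1/2) t)) = norm (Gamma (Complex (- real n - 1/2) t)) * z powr (real n + 1/2)"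
        using assms by (simp add: f_def norm_mult norm_powr_real_powr add.commute)
      also have "\<dots> \<le> (2 / fact n * norm (Gamma (Complex (1/2) t))) * z powr (real n + 1/2)"
        by (intro mult_right_mono norm_Gamma_left_half_plane_le) auto
      also have "z powr (real n + 1/2) = z ^ n * z powr (1/2)"
        using assms by (simp add: powr_add powr_realpow)
      finally show "norm (f (Complex (- real n - 1/2) t)) \<le> z powr (1/2) * 2 * (z ^ n / fact n) * norm (Gamma (Complex (1/2) t))"
        by (simp add: mult_ac)
    qed
    also have "\<dots> = z powr (1/2) * 2 * K * (z ^ n / fact n)"
      by (simp add: K_def mult_ac)
    finally show ?thesis .
  qed
  have "(\<lambda>n. z powr (1/2) * 2 * K * (z ^ n / fact n)) \<longlonglongrightarrow> z powr (1/2) * 2 * K * 0"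
    using summable_LIMSEQ_zero[OF summable_exp[of z]] by (intro tendsto_intros) (simp add: divide_inverse mult_ac)
  then have "(\<lambda>n. LINT t|lborel. f (Complex (- real n - 1/2) t)) \<longlonglongrightarrow> 0"
    by (intro Lim_null_comparison[OF always_eventually[OF allI[OF rem]]]) simp
  moreover have "(\<lambda>n. \<Sum>k\<le>n. (- z) ^ k / fact k) \<longlonglongrightarrow> exp (- z)"
    using exp_converges[of "- z"] by (simp add: sums_def_le divide_inverse mult_ac)
  ultimately have "(\<lambda>n. (LINT t|lborel. f (Complex (- real n - 1/2) t)) + complex_of_real (2 * pi * (\<Sum>k\<le>n. (- z) ^ k / fact k)))
      \<longlonglongrightarrow> 0 + complex_of_real (2 * pi * exp (- z))"
    by (intro tendsto_intros)
  moreover have "(LINT t|lborel. f (Complex (- real n - 1/2) t)) + complex_of_real (2 * pi * (\<Sum>k\<le>n. (- z) ^ k / fact k)) =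
      (LINT t|lborel. f (Complex 1 t))" for n
    unfolding shift[symmetric] by simp
  ultimately have "(LINT t|lborel. f (Complex 1 t)) = complex_of_real (2 * pi * exp (- z))"
    by (simp add: LIMSEQ_const_iff)
  then show ?thesis by (simp add: f_def)
qed

text \<open>There are no right poles and the left ones are the nonpositive integers, so the line Re
  s = 1 of the Cahen--Mellin integral separates them.\<close>

lemma meijer_G_1_0_0_1:
  assumes "z > 0"
  shows "meijer_G 1 0 [] [0] (of_real z) = of_real (exp (- z))"
proof -
  have f: "meijer_G_integrand 1 0 [] [0] (of_real z) = (\<lambda>s. Gamma s * complex_of_real z powr (- s))"
    by (auto simp: meijer_G_integrand_def fun_eq_iff)
  have "meijer_G 1 0 [] [0] (of_real z) =
     1 / (2 * pi) * (LINT t|lborel. meijer_G_integrand 1 0 [] [0] (of_real z) (Complex 1 t))"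
    using assms strip_decay_mult[OF strip_decay_Gamma[of 2] strip_decay_powr[OF assms]]
    by (intro meijer_G_eq_vertical_integral)
       (auto simp: f meijer_G_left_poles_def meijer_G_right_poles_def simp del: One_nat_def)
  then show ?thesis unfolding f Cahen_Mellin[OF assms] by simp
qed

section \<open>Mellin transforms and the G-functions of the theorem\<close>

lemma of_real_powr_eq_exp:
  "x > 0 \<Longrightarrow> complex_of_real x powr w = exp (w * of_real (ln x))"
  by (simp add: powr_def Ln_of_real)

section \<open>Multiplication formula and Mellin transform of a stretched exponential\<close>

text \<open>Gamma s for r = 1 and Gamma s * Gamma (s + 1/2) for r = 2: the product in the
  multiplication formula for Gamma (r s).\<close>

definition Gamma_prod :: "nat \<Rightarrow> complex \<Rightarrow> complex" where
  "Gamma_prod r s = (\<Prod>i<r. Gamma (of_real (zero_half r ! i) + s))"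

lemma length_zero_half: "r \<in> {1, 2} \<Longrightarrow> length (zero_half r) = r"
  by (auto simp: zero_half_def)

lemma zero_half_nonneg: "r \<in> {1, 2} \<Longrightarrow> i < r \<Longrightarrow> zero_half r ! i \<ge> 0"
  by (auto simp: zero_half_def dest: less_2_cases)

text \<open>Gauss's form of the formula, uniform in r: trivial for r = 1, Legendre's duplication for
  r = 2.\<close>

lemma Gamma_prod_multiplication:
  assumes "r \<in> {1, 2}" "Re w > 0"
  shows "Gamma (of_nat r * w) =
    of_real ((2 * pi) powr (- ((real r - 1) / 2))) * of_real (real r) powr (of_nat r * w - 1/2) * Gamma_prod r w"
  using assms(1)
proof (elim insertE emptyE)
  assume r: "r = 2"
  have "w \<notin> \<int>\<^sub>\<le>\<^sub>0" "w + 1/2 \<notin> \<int>\<^sub>\<le>\<^sub>0"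
    using assms(2) by (auto elim!: nonpos_Ints_cases simp: complex_eq_iff)
  from Gamma_legendre_duplication[OF this]
  have "Gamma_prod r w = exp ((1 - 2 * w) * of_real (ln 2)) * of_real (sqrt pi) * Gamma (2 * w)"
    by (simp add: Gamma_prod_def r zero_half_def numeral_2_eq_2 lessThan_Suc mult_ac add_ac)
  moreover have "complex_of_real 2 powr (2 * w - 1/2) = exp ((2 * w - 1/2) * of_real (ln 2))"
    by (rule of_real_powr_eq_exp) simp
  moreover have "exp ((2 * w - 1/2) * of_real (ln 2)) * exp ((1 - 2 * w) * of_real (ln 2)) = complex_of_real (sqrt 2)"
  proof -
    have "exp ((2 * w - 1/2) * of_real (ln 2)) * exp ((1 - 2 * w) * of_real (ln 2)) = exp (complex_of_real (1/2 * ln 2))"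
      unfolding exp_add[symmetric] by (simp add: algebra_simps)
    also have "\<dots> = of_real (exp (1/2 * ln 2))" by (rule exp_of_real)
    also have "exp (1/2 * ln 2) = sqrt (2::real)"
      by (simp add: powr_half_sqrt[symmetric] powr_def)
    finally show ?thesis .
  qed
  \<comment> \<open>\<open>sqrt 2\<close> is left over from the powers of 2 and
    \<open>sqrt pi\<close> comes from Legendre's formula; Gauss's constant absorbs both.\<close>
  moreover have "(2 * pi) powr (- ((real r - 1) / 2)) * sqrt 2 * sqrt pi = 1"
  proof -
    have "(2 * pi) powr (- ((real r - 1) / 2)) = inverse (sqrt (2 * pi))"
      unfolding powr_minus by (simp add: r powr_half_sqrt)
    then show ?thesis by (simp add: real_sqrt_mult field_simps)
  qed
  then have "of_real ((2 * pi) powr (- ((real r - 1) / 2))) * complex_of_real (sqrt 2) * complex_of_real (sqrt pi) = 1"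
    by (metis of_real_1 of_real_mult)
  ultimately show ?thesis by (simp add: r mult_ac)
qed (simp add: Gamma_prod_def zero_half_def)

text \<open>Substituting \<open>x = \<mu> (u / \<beta>) ^ r\<close> turns the integral into Euler's integral for \<open>Gamma (r w)\<close>.\<close>

lemma Mellin_stretched_exponential:
  fixes r :: nat and w :: complex and \<beta> \<mu> :: real
  defines "f \<equiv> \<lambda>x. of_real x powr (w - 1) * of_real (exp (- (\<beta> * (x / \<mu>) powr (1 / real r))))"
  assumes r: "r \<ge> 1" and pos: "\<beta> > 0" "\<mu> > 0" "Re w > 0"
  shows "set_integrable lborel {0<..} f"
    and "(LINT x:{0<..}|lborel. f x) = of_nat r * Gamma (of_nat r * w) * of_real (\<beta> ^ r / \<mu>) powr (- w)"
proof -
  define \<kappa> where "\<kappa> = \<mu> / \<beta> ^ r"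
  define g where "g = (\<lambda>u::real. \<kappa> * u ^ r)"
  define g' where "g' = (\<lambda>u::real. \<kappa> * (real r * u ^ (r - 1)))"
  define C where "C = of_nat r * of_real \<kappa> powr w"
  have \<kappa>: "\<kappa> > 0" using pos by (simp add: \<kappa>_def)
  have Rw: "Re (of_nat r * w) > 0" using r pos by simp
  have img: "g ` {0<..} = {0<..}"
  proof (intro equalityI subsetI)
    fix x :: real assume "x \<in> {0<..}"
    then have "x = g (root r (x / \<kappa>))" "root r (x / \<kappa>) > 0"
      using \<kappa> r by (simp_all add: g_def real_root_pow_pos2)
    then show "x \<in> g ` {0<..}" by blast
  qed (use \<kappa> in \<open>auto simp: g_def\<close>)
  have inj: "inj_on g {0<..}"
    using \<kappa> r by (auto simp: g_def inj_on_def power_eq_iff_eq_base)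
  have der: "(g has_field_derivative g' u) (at u within {0<..})" for u
    unfolding g_def g'_def by (auto intro!: derivative_eq_intros)
  \<comment> \<open>The exponents of u add up as (r - 1) + r (w - 1) = r w - 1, those of \<kappa> as
    1 + (w - 1) = w; the latter power goes into \<open>C\<close>.\<close>
  have eq: "\<bar>g' u\<bar> *\<^sub>R f (g u) = C * (of_real u powr (of_nat r * w - 1) / of_real (exp u))" if "u \<in> {0<..}" for u
  proof -
    have u: "u > 0" using that by simp
    have "g u / \<mu> = (u / \<beta>) powr real r"
      using u pos by (simp add: g_def \<kappa>_def powr_realpow power_divide)
    then have "(g u / \<mu>) powr (1 / real r) = u / \<beta>"
      using u pos r by (simp add: powr_powr)
    then have e: "exp (- (\<beta> * (g u / \<mu>) powr (1 / real r))) = inverse (exp u)"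
      using pos by (simp add: exp_minus)
    have "\<bar>g' u\<bar> = g' u" using u \<kappa> by (simp add: g'_def)
    also have "\<dots> = real r * \<kappa> * exp ((real r - 1) * ln u)"
      using u r by (simp add: g'_def powr_realpow[symmetric] powr_def of_nat_diff)
    finally have "\<bar>g' u\<bar> = real r * \<kappa> * exp ((real r - 1) * ln u)" .
    moreover have "complex_of_real (exp ((real r - 1) * ln u)) = exp ((of_nat r - 1) * of_real (ln u))"
      unfolding exp_of_real[symmetric] by simp
    moreover have "complex_of_real \<kappa> = exp (of_real (ln \<kappa>))"
      unfolding exp_of_real using \<kappa> by simp
    ultimately have a: "complex_of_real \<bar>g' u\<bar> = of_nat r * exp (of_real (ln \<kappa>)) * exp ((of_nat r - 1) * of_real (ln u))"
      by simp
    have "g u > 0" using u \<kappa> by (simp add: g_def)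
    moreover have "ln (g u) = ln \<kappa> + real r * ln u"
      using u \<kappa> by (simp add: g_def ln_mult ln_realpow)
    ultimately have b: "of_real (g u) powr (w - 1) = exp ((w - 1) * of_real (ln \<kappa> + real r * ln u))"
      by (simp only: of_real_powr_eq_exp)
    have "exp (of_real (ln \<kappa>)) * exp ((of_nat r - 1) * of_real (ln u)) * exp ((w - 1) * of_real (ln \<kappa> + real r * ln u))
       = exp (w * of_real (ln \<kappa>)) * exp ((of_nat r * w - 1) * complex_of_real (ln u))"
      unfolding exp_add[symmetric] by (simp add: algebra_simps)
    then show ?thesis
      using u \<kappa> unfolding f_def e scaleR_conv_of_real a b
      by (simp add: C_def of_real_powr_eq_exp divide_inverse mult.assoc)
  qed
  have int: "(\<lambda>u. C * (of_real u powr (of_nat r * w - 1) / of_real (exp u))) absolutely_integrable_on {0<..}"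
    using absolutely_integrable_Gamma_integral'[OF Rw] by (rule set_integrable_mult_right)
  have val: "integral {0<..} (\<lambda>u. C * (of_real u powr (of_nat r * w - 1) / of_real (exp u))) = C * Gamma (of_nat r * w)"
    using Gamma_integral_complex'[OF Rw] by (intro integral_unique has_integral_mult_right)
  have "(\<lambda>u. \<bar>g' u\<bar> *\<^sub>R f (g u)) absolutely_integrable_on {0<..} \<and>
      integral {0<..} (\<lambda>u. \<bar>g' u\<bar> *\<^sub>R f (g u)) = C * Gamma (of_nat r * w)"
  proof
    show "(\<lambda>u. \<bar>g' u\<bar> *\<^sub>R f (g u)) absolutely_integrable_on {0<..}"
      using int eq by (subst set_integrable_cong[OF refl refl]) auto
    show "integral {0<..} (\<lambda>u. \<bar>g' u\<bar> *\<^sub>R f (g u)) = C * Gamma (of_nat r * w)"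
      unfolding val[symmetric] by (intro Henstock_Kurzweil_Integration.integral_cong eq)
  qed
  then have fg: "f absolutely_integrable_on {0<..}" "integral {0<..} f = C * Gamma (of_nat r * w)"
    using has_absolute_integral_change_of_variables_real[of "{0<..}" g g' f] inj der img by auto
  \<comment> \<open>\<open>absolutely_integrable_on\<close> refers to the completed measure; Borel
    measurability brings the result back to \<open>lborel\<close>.\<close>
  have meas: "(\<lambda>x. indicator {0<..} x *\<^sub>R f x) \<in> borel_measurable lborel"
  proof -
    have "(\<lambda>x. indicator {0<..} x *\<^sub>R f x) = (\<lambda>x. indicator {0<..} x *\<^sub>R
        (exp ((w - 1) * of_real (ln x)) * of_real (exp (- (\<beta> * (x / \<mu>) powr (1 / real r))))))"
      by (auto simp: fun_eq_iff f_def of_real_powr_eq_exp indicator_def)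
    also have "\<dots> \<in> borel_measurable lborel" by measurable
    finally show ?thesis .
  qed
  then show *: "set_integrable lborel {0<..} f"
    using fg(1) unfolding set_integrable_def by (simp add: integrable_completion)
  have "\<beta> ^ r / \<mu> = inverse \<kappa>" "inverse \<kappa> > 0" using pos by (simp_all add: \<kappa>_def)
  then have "of_real (\<beta> ^ r / \<mu>) powr (- w) = exp (- w * of_real (- ln \<kappa>))"
    using \<kappa> by (simp only: of_real_powr_eq_exp ln_inverse)
  also have "\<dots> = of_real \<kappa> powr w" using \<kappa> by (simp add: of_real_powr_eq_exp)
  finally have "of_real (\<beta> ^ r / \<mu>) powr (- w) = of_real \<kappa> powr w" .
  then show "(LINT x:{0<..}|lborel. f x) = of_nat r * Gamma (of_nat r * w) * of_real (\<beta> ^ r / \<mu>) powr (- w)"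
    using fg(2) set_borel_integral_eq_integral(2)[OF *] by (simp add: C_def)
qed

section \<open>Exchange of the two integrations\<close>

text \<open>The kernel has modulus 1 for positive x, so the double integrand is dominated by
  \<open>norm (\<phi> t) * norm (h x)\<close>. The real part of the exponent of x is meant to be
  absorbed into \<open>h\<close> beforehand.\<close>

lemma Mellin_Fubini:
  fixes \<phi> :: "real \<Rightarrow> complex" and h :: "real \<Rightarrow> complex"
  assumes \<phi>: "integrable lborel \<phi>" and h: "set_integrable lborel {0<..} h"
  shows "(LINT x:{0<..}|lborel. (LINT t|lborel. \<phi> t * of_real x powr (- (\<i> * of_real t))) * h x) =
         (LINT t|lborel. \<phi> t * (LINT x:{0<..}|lborel. of_real x powr (- (\<i> * of_real t)) * h x))"
proof -
  define H where "H = (\<lambda>x. indicator {0<..} x *\<^sub>R h x)"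
  \<comment> \<open>Agrees with the kernel for x > 0, but is measurable and of modulus 1 for every
    real x.\<close>
  define e where "e = (\<lambda>x t :: real. exp (- (\<i> * complex_of_real t) * of_real (ln x)))"
  define F where "F = (\<lambda>x t. \<phi> t * e x t * H x)"
  have H: "integrable lborel H" using h by (simp add: H_def set_integrable_def)
  have [measurable]: "\<phi> \<in> borel_measurable lborel" "H \<in> borel_measurable lborel"
    using \<phi> H by auto
  have norm_e: "norm (e x t) = 1" for x t
    unfolding e_def norm_exp_eq_Re by simp
  have [measurable]: "(\<lambda>p. e (fst p) (snd p)) \<in> borel_measurable (lborel \<Otimes>\<^sub>M lborel)"
    unfolding e_def by measurable
  have F_meas: "case_prod F \<in> borel_measurable (lborel \<Otimes>\<^sub>M lborel)"
    unfolding F_def case_prod_beta' by measurable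
  have e_meas: "e x \<in> borel_measurable lborel" for x
    unfolding e_def by measurable
  have int: "integrable (lborel \<Otimes>\<^sub>M lborel) (case_prod F)"
  proof (rule lborel_pair.Fubini_integrable[OF F_meas])
    have "(\<lambda>x. LINT t|lborel. norm (case_prod F (x, t))) = (\<lambda>x. (LINT t|lborel. norm (\<phi> t)) * norm (H x))"
      by (simp add: F_def norm_mult norm_e)
    then show "integrable lborel (\<lambda>x. LINT t|lborel. norm (case_prod F (x, t)))"
      using H by simp
    have "integrable lborel (\<lambda>t. \<phi> t * e x t)" for x
      by (rule Bochner_Integration.integrable_bound[OF \<phi>]) (use e_meas in \<open>auto simp: norm_mult norm_e\<close>)
    then show "AE x in lborel. integrable lborel (\<lambda>t. case_prod F (x, t))"
      by (simp add: F_def)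
  qed
  have eq: "of_real x powr (- (\<i> * of_real t)) = e x t" if "x > 0" for x t
    using that by (simp add: of_real_powr_eq_exp e_def)
  have "(LINT x:{0<..}|lborel. (LINT t|lborel. \<phi> t * of_real x powr (- (\<i> * of_real t))) * h x) =
     (LINT x|lborel. LINT t|lborel. F x t)"
    unfolding set_lebesgue_integral_def
    by (intro Bochner_Integration.integral_cong) (auto simp: F_def H_def eq indicator_def)
  also have "\<dots> = (LINT t|lborel. LINT x|lborel. F x t)"
    by (rule lborel_pair.Fubini_integral[OF int, symmetric])
  also have "\<dots> = (LINT t|lborel. \<phi> t * (LINT x:{0<..}|lborel. of_real x powr (- (\<i> * of_real t)) * h x))"
  proof (intro Bochner_Integration.integral_cong refl)
    fix t
    have "(LINT x|lborel. F x t) = \<phi> t * (LINT x|lborel. e x t * H x)"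
      by (simp add: F_def mult.assoc)
    also have "(LINT x|lborel. e x t * H x) = (LINT x:{0<..}|lborel. of_real x powr (- (\<i> * of_real t)) * h x)"
      unfolding set_lebesgue_integral_def
      by (intro Bochner_Integration.integral_cong) (auto simp: H_def eq indicator_def)
    finally show "(LINT x|lborel. F x t) = \<phi> t * (LINT x:{0<..}|lborel. of_real x powr (- (\<i> * of_real t)) * h x)" .
  qed
  finally show ?thesis .
qed

section \<open>The two G-functions of the theorem along vertical lines\<close>

lemma strip_decay_Gamma_prod:
  assumes "r \<in> {1, 2}"
  shows "strip_decay 2 (Gamma_prod r)"
  using assms
proof (elim insertE emptyE)
  assume "r = 2"
  then show ?thesis
    using strip_decay_mono[OF strip_decay_mult[OF strip_decay_Gamma_shift(1)[of 2 0] strip_decay_Gamma_shift(1)[of 2 "1/2"]], of 2]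
    by (simp add: Gamma_prod_def[abs_def] zero_half_def numeral_2_eq_2 lessThan_Suc mult_ac)
qed (use strip_decay_Gamma in \<open>simp add: Gamma_prod_def[abs_def] zero_half_def\<close>)

lemma strip_decay_inverse_diff':
  "strip_decay 0 (\<lambda>s. 1 / (s - p))" "strip_decay 0 (\<lambda>s. 1 / (p - s))"
proof -
  have *: "strip_decay 0 (\<lambda>s. 1 / (s - p))" for p
    using strip_decay_mono[OF strip_decay_inverse_diff] by simp
  show "strip_decay 0 (\<lambda>s. 1 / (s - p))" by (rule *)
  have "strip_decay 0 (\<lambda>s. - 1 * (1 / (s - p)))"
    using *[of p] by (auto simp: strip_decay_def)
  then show "strip_decay 0 (\<lambda>s. 1 / (p - s))"
    by (simp add: minus_divide_right)
qed

lemma Gamma_divide_Gamma_plus1: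
  fixes s :: complex
  assumes "s \<notin> \<int>\<^sub>\<le>\<^sub>0"
  shows "Gamma s / Gamma (1 + s) = 1 / s"
  using assms Gamma_plus1[OF assms] by (simp add: add.commute Gamma_eq_zero_iff)

lemma not_nonpos_Ints_complexI:
  "Im s \<noteq> 0 \<or> Re s > 0 \<Longrightarrow> s \<notin> \<int>\<^sub>\<le>\<^sub>0"
  by (auto elim!: nonpos_Ints_cases)

text \<open>The parameters 1 - \<rho> and - \<rho> produce Gamma (\<rho> - s) / Gamma (1 + \<rho> -
  s), which collapses to 1 / (\<rho> - s). The left poles have real part at most 0 and the right
  ones at least \<rho>, so every c in between gives a separating line.\<close>

lemma meijer_G_cdf:
  fixes \<Phi> :: "complex \<Rightarrow> complex" and y c \<rho> :: real
  assumes r: "r \<in> {1, 2}" and y: "y > 0" and c: "0 < c" "c < \<rho>"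
  defines "\<Phi> \<equiv> \<lambda>s. Gamma_prod r s / (of_real \<rho> - s) * of_real y powr (- s)"
  shows "integrable lborel (\<lambda>t. \<Phi> (Complex c t))"
    and "meijer_G r 1 [of_real (1 - \<rho>)] (map of_real (zero_half r @ [- \<rho>])) (of_real y) =
           1 / (2 * pi) * (LINT t|lborel. \<Phi> (Complex c t))"
proof -
  define a where "a = [complex_of_real (1 - \<rho>)]"
  define b where "b = map complex_of_real (zero_half r @ [- \<rho>])"
  have len: "length a = 1" "length b = r + 1" using r by (auto simp: a_def b_def length_zero_half)
  have b: "b ! i = of_real (zero_half r ! i)" if "i < r" for i
    using that r by (simp add: b_def nth_append length_zero_half)
  have br: "b ! r = - of_real \<rho>"
    using r by (simp add: b_def nth_append length_zero_half)
  have eq: "meijer_G_integrand r 1 a b (of_real y) s = \<Phi> s" if "Im s \<noteq> 0 \<or> Re s < \<rho>" for s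
  proof -
    have "meijer_G_integrand r 1 a b (of_real y) s =
       Gamma_prod r s * (Gamma (of_real \<rho> - s) / Gamma (1 + (of_real \<rho> - s))) * of_real y powr (- s)"
      using b br len by (simp add: meijer_G_integrand_def Gamma_prod_def a_def algebra_simps)
    also have "\<dots> = \<Phi> s"
      using that by (subst Gamma_divide_Gamma_plus1) (auto simp: \<Phi>_def intro!: not_nonpos_Ints_complexI)
    finally show ?thesis .
  qed
  have dec: "strip_decay 2 (meijer_G_integrand r 1 a b (of_real y))"
  proof (rule strip_decay_cong[of 1])
    show "strip_decay 2 \<Phi>"
      using strip_decay_mult[OF strip_decay_mult[OF strip_decay_Gamma_prod[OF r] strip_decay_inverse_diff'(2)] strip_decay_powr[OF y]]
      by (simp add: \<Phi>_def)
  qed (auto intro!: eq simp del: One_nat_def)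
  have left: "Re p < c" if "p \<in> meijer_G_left_poles r b" for p
    using that c zero_half_nonneg[OF r] b by (fastforce simp: meijer_G_left_poles_def)
  have right: "Re p > c" if "p \<in> meijer_G_right_poles 1 a" for p
    using that c by (auto simp: meijer_G_right_poles_def a_def)
  note * = meijer_G_eq_vertical_integral[of "of_real y" r b c 1 a, OF _ left right dec]
  show "integrable lborel (\<lambda>t. \<Phi> (Complex c t))"
    using * y c eq[of "Complex c t" for t] by simp
  show "meijer_G r 1 [of_real (1 - \<rho>)] (map of_real (zero_half r @ [- \<rho>])) (of_real y) =
           1 / (2 * pi) * (LINT t|lborel. \<Phi> (Complex c t))"
    using * y c eq[of "Complex c t" for t] by (simp add: a_def b_def)
qed

text \<open>The first r upper parameters satisfy 1 - a_i = b_i + \<rho> + \<nu>, so their Gamma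
  factors form \<open>Gamma_prod\<close> at the reflected point. The last one is \<omega> + \<rho> =
  1 - \<nu>; with the lower parameter - \<nu> it yields 1 / (s - \<nu>). That pole counts as a left
  one, hence \<nu> < d, while the right poles start at \<rho> + \<nu>.\<close>

lemma meijer_G_sop:
  fixes r :: nat and \<rho> \<nu> \<omega> z d :: real
  assumes r: "r \<in> {1, 2}" and z: "z > 0" and d: "0 \<le> \<nu>" "\<nu> < d" "d < \<rho> + \<nu>"
    and \<omega>: "\<omega> = 1 - \<rho> - \<nu>"
    and t5: "t5 = (if r = 1 then [\<omega>, \<omega> + \<rho>] else [\<omega>, \<omega> - 1/2, \<omega> + \<rho>])"
  shows "meijer_G (r + 1) r (map of_real t5) (map of_real (zero_half r @ [- \<nu>])) (of_real z) =
           1 / (2 * pi) * (LINT t|lborel. Gamma_prod r (Complex d t) * Gamma_prod r (of_real (\<rho> + \<nu>) - Complex d t) /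
             (Complex d t - of_real \<nu>) * of_real z powr (- Complex d t))"
proof -
  define \<Phi> where "\<Phi> = (\<lambda>s. Gamma_prod r s * Gamma_prod r (of_real (\<rho> + \<nu>) - s) /
             (s - of_real \<nu>) * of_real z powr (- s))"
  define a where "a = map complex_of_real t5"
  define b where "b = map complex_of_real (zero_half r @ [- \<nu>])"
  have len: "length a = r + 1" "length b = r + 1" using r by (auto simp: a_def b_def t5 length_zero_half)
  have b: "b ! i = of_real (zero_half r ! i)" if "i < r" for i
    using that r by (simp add: b_def nth_append length_zero_half)
  have br: "b ! r = - of_real \<nu>"
    using r by (simp add: b_def nth_append length_zero_half)
  have a: "1 - a ! i = of_real (zero_half r ! i) + of_real (\<rho> + \<nu>)" if "i < r" for i
    using that r by (auto simp: a_def t5 zero_half_def \<omega> dest!: less_2_cases)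
  have ar: "a ! r = 1 - of_real \<nu>"
    using r by (auto simp: a_def t5 \<omega> numeral_2_eq_2)
  have eq: "meijer_G_integrand (r + 1) r a b (of_real z) s = \<Phi> s" if "Im s \<noteq> 0 \<or> Re s > \<nu>" for s
  proof -
    have "meijer_G_integrand (r + 1) r a b (of_real z) s =
       Gamma_prod r s * Gamma_prod r (of_real (\<rho> + \<nu>) - s) *
       (Gamma (s - of_real \<nu>) / Gamma (1 + (s - of_real \<nu>))) * of_real z powr (- s)"
    proof -
      have "(\<Prod>i<r. Gamma (1 - a ! i - s)) = Gamma_prod r (of_real (\<rho> + \<nu>) - s)"
        unfolding Gamma_prod_def by (intro prod.cong refl) (simp add: a add_diff_eq)
      moreover have "(\<Prod>i<r. Gamma (b ! i + s)) = Gamma_prod r s"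
        unfolding Gamma_prod_def by (intro prod.cong refl) (simp add: b)
      moreover have "Gamma (a ! r + s) = Gamma (1 + (s - of_real \<nu>))" "Gamma (b ! r + s) = Gamma (s - of_real \<nu>)"
        by (simp_all add: ar br algebra_simps)
      ultimately show ?thesis
        unfolding meijer_G_integrand_def len by (simp del: of_real_add)
    qed
    also have "\<dots> = \<Phi> s"
      using that by (subst Gamma_divide_Gamma_plus1) (auto simp: \<Phi>_def intro!: not_nonpos_Ints_complexI)
    finally show ?thesis .
  qed
  have dec: "strip_decay 2 (meijer_G_integrand (r + 1) r a b (of_real z))"
  proof (rule strip_decay_cong[of 1])
    have "strip_decay 2 (\<lambda>s. Gamma_prod r (of_real (\<rho> + \<nu>) - s))"
      using strip_decay_uminus[OF strip_decay_shift[OF strip_decay_Gamma_prod[OF r]]] by simp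
    from strip_decay_mult[OF strip_decay_mult[OF strip_decay_mult[OF strip_decay_Gamma_prod[OF r] this] strip_decay_inverse_diff'(1)] strip_decay_powr[OF z]]
    have "strip_decay 4 \<Phi>" by (simp add: \<Phi>_def)
    then show "strip_decay 2 \<Phi>" by (rule strip_decay_mono) simp
  qed (use eq in force)
  have left: "Re p < d" if "p \<in> meijer_G_left_poles (r + 1) b" for p
  proof -
    obtain i k where "p = - (b ! i) - of_nat k" "i < r \<or> i = r"
      using \<open>p \<in> _\<close> by (auto simp: meijer_G_left_poles_def less_Suc_eq)
    then show ?thesis using d zero_half_nonneg[OF r, of i] b[of i] br by auto
  qed
  have right: "Re p > d" if "p \<in> meijer_G_right_poles r a" for p
    using that d zero_half_nonneg[OF r] a by (fastforce simp: meijer_G_right_poles_def)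
  note * = meijer_G_eq_vertical_integral(2)[of "of_real z" "r + 1" b d r a, OF _ left right dec]
  have "meijer_G (r + 1) r a b (of_real z) = 1 / (2 * pi) * (LINT t|lborel. \<Phi> (Complex d t))"
    using * z d eq[of "Complex d t" for t] by simp
  then show ?thesis by (simp add: a_def b_def \<Phi>_def)
qed

section \<open>Evaluation of the integral\<close>

text \<open>The multiplication formula brings r powr (r w - 1/2). Its part r powr (r w) moves into
  the base of the power, whence r ^ r in the argument of the closed form; the part r powr (- 1/2)
  turns the Jacobian factor r into \<open>sqrt r\<close>.\<close>

lemma Mellin_stretched_exponential_Gamma_prod:
  assumes "r \<in> {1, 2}" "\<beta> > 0" "\<mu> > 0" "Re w > 0"
  shows "(LINT x:{0<..}|lborel. of_real x powr (w - 1) * of_real (exp (- (\<beta> * (x / \<mu>) powr (1 / real r))))) =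
     of_real (sqrt (real r) * (2 * pi) powr (- ((real r - 1) / 2))) * Gamma_prod r w *
     of_real (\<beta> ^ r / (real r ^ r * \<mu>)) powr (- w)"
proof -
  define R where "R = of_nat r * complex_of_real (real r) powr (of_nat r * w - 1/2)"
  have r: "real r > 0" "r \<ge> 1" using assms(1) by auto
  have "(LINT x:{0<..}|lborel. of_real x powr (w - 1) * of_real (exp (- (\<beta> * (x / \<mu>) powr (1 / real r))))) =
      of_real ((2 * pi) powr (- ((real r - 1) / 2))) * Gamma_prod r w *
      (R * of_real (\<beta> ^ r / \<mu>) powr (- w))"
    unfolding Mellin_stretched_exponential(2)[OF r(2) assms(2-4)] Gamma_prod_multiplication[OF assms(1,4)] R_def
    by (simp only: mult_ac)
  also have "R * of_real (\<beta> ^ r / \<mu>) powr (- w) =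
     of_real (sqrt (real r)) * of_real (\<beta> ^ r / (real r ^ r * \<mu>)) powr (- w)"
  proof -
    have "sqrt (real r) = exp (1/2 * ln (real r))"
      using r by (simp add: powr_half_sqrt[symmetric] powr_def)
    then have sq: "complex_of_real (sqrt (real r)) = exp (1/2 * of_real (ln (real r)))"
      by (simp add: exp_of_real[symmetric])
    have nat: "complex_of_nat r = exp (of_real (ln (real r)))"
      using r by (simp add: exp_of_real)
    have pos: "\<beta> ^ r / \<mu> > 0" "\<beta> ^ r / (real r ^ r * \<mu>) > 0" using assms r by auto
    have "ln (\<beta> ^ r / (real r ^ r * \<mu>)) = ln (\<beta> ^ r / \<mu>) - real r * ln (real r)"
      using assms r by (simp add: ln_div ln_mult ln_realpow)
    then have "of_real (\<beta> ^ r / (real r ^ r * \<mu>)) powr (- w) =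
       exp (- w * (of_real (ln (\<beta> ^ r / \<mu>)) - of_nat r * of_real (ln (real r))))"
      using pos(2) by (simp only: of_real_powr_eq_exp of_real_diff of_real_mult of_real_of_nat_eq)
    moreover have "of_real (\<beta> ^ r / \<mu>) powr (- w) = exp (- w * of_real (ln (\<beta> ^ r / \<mu>)))"
      using pos(1) by (simp only: of_real_powr_eq_exp)
    moreover have "complex_of_real (real r) powr (of_nat r * w - 1/2) = exp ((of_nat r * w - 1/2) * of_real (ln (real r)))"
      using r by (simp only: of_real_powr_eq_exp)
    ultimately show ?thesis
      unfolding R_def sq by (subst nat) (simp add: exp_add[symmetric] algebra_simps)
  qed
  finally show ?thesis by (simp only: of_real_mult mult_ac)
qed

lemma integral_meijer_G_stretched_exponential:
  fixes r :: nat and \<rho> \<nu> A \<beta> \<mu> \<omega> :: real and t5 :: "real list"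
  assumes r: "r \<in> {1, 2}" and pos: "\<rho> > 0" "\<nu> > 0" "A > 0" "\<beta> > 0" "\<mu> > 0"
    and \<omega>: "\<omega> = 1 - \<rho> - \<nu>"
    and t5: "t5 = (if r = 1 then [\<omega>, \<omega> + \<rho>] else [\<omega>, \<omega> - 1/2, \<omega> + \<rho>])"
  shows "(LINT x:{0<..}|lborel.
      meijer_G r 1 [of_real (1 - \<rho>)] (map of_real (zero_half r @ [- \<rho>])) (of_real (A * x)) *
      of_real (x powr (\<rho> + \<nu> - 1) * exp (- (\<beta> * (x / \<mu>) powr (1 / real r))))) =
    of_real (sqrt (real r) * (2 * pi) powr (- ((real r - 1) / 2)) * A powr (- (\<rho> + \<nu>))) *
    meijer_G (r + 1) r (map of_real t5) (map of_real (zero_half r @ [- \<nu>]))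
      (of_real (\<beta> ^ r / (real r ^ r * \<mu>) / A))"
proof -
  \<comment> \<open>The midpoint of the interval allowed for c; its mirror image a lies between
    \<nu> and \<rho> + \<nu>, exactly where the closed form has its separating lines.\<close>
  define c a where "c = \<rho> / 2" and "a = \<rho> + \<nu> - c"
  have c: "0 < c" "c < \<rho>" and a: "\<nu> < a" "a < \<rho> + \<nu>" "a > 0" using pos by (auto simp: c_def a_def)
  define B where "B = \<beta> ^ r / (real r ^ r * \<mu>)"
  have B: "B > 0" using pos r by (auto simp: B_def)
  define K where "K = sqrt (real r) * (2 * pi) powr (- ((real r - 1) / 2))"
  define E where "E = (\<lambda>x. exp (- (\<beta> * (x / \<mu>) powr (1 / real r))))"
  define \<phi> where "\<phi> = (\<lambda>t. Gamma_prod r (Complex c t) / (of_real \<rho> - Complex c t) * of_real A powr (- Complex c t))"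
  define H where "H = (\<lambda>x. complex_of_real x powr (of_real a - 1) * of_real (E x))"
  have G1: "meijer_G r 1 [of_real (1 - \<rho>)] (map of_real (zero_half r @ [- \<rho>])) (of_real (A * x)) *
      of_real (x powr (\<rho> + \<nu> - 1) * E x) =
      1 / (2 * pi) * ((LINT t|lborel. \<phi> t * of_real x powr (- (\<i> * of_real t))) * H x)" if x: "x > 0" for x
  proof -
    have "A * x > 0" using pos x by simp
    \<comment> \<open>The factor x powr (- c) joins \<open>H\<close>, so that only the unimodular
      part of the power still couples x and t.\<close>
    have split: "of_real (A * x) powr (- Complex c t) =
        of_real A powr (- Complex c t) * of_real x powr (- (\<i> * of_real t)) * of_real (x powr (- c))" for t
    proof -
      have "complex_of_real (x powr (- c)) = exp (- of_real c * of_real (ln x))"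
        using x by (simp add: powr_def exp_of_real[symmetric])
      then show ?thesis
        using pos x \<open>A * x > 0\<close>
        by (simp add: of_real_powr_eq_exp ln_mult exp_add[symmetric] Complex_eq algebra_simps
              del: of_real_mult)
    qed
    have "meijer_G r 1 [of_real (1 - \<rho>)] (map of_real (zero_half r @ [- \<rho>])) (of_real (A * x)) =
        1 / (2 * pi) * (LINT t|lborel. \<phi> t * of_real x powr (- (\<i> * of_real t)) * of_real (x powr (- c)))"
      unfolding meijer_G_cdf(2)[OF r \<open>A * x > 0\<close> c] split \<phi>_def by (simp only: mult.assoc)
    also have "\<dots> = 1 / (2 * pi) * ((LINT t|lborel. \<phi> t * of_real x powr (- (\<i> * of_real t))) * of_real (x powr (- c)))"
      by (simp only: integral_mult_left_zero)
    finally have "meijer_G r 1 [of_real (1 - \<rho>)] (map of_real (zero_half r @ [- \<rho>])) (of_real (A * x)) = \<dots>" .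
    moreover have "of_real (x powr (- c)) * of_real (x powr (\<rho> + \<nu> - 1) * E x) = H x"
    proof -
      have "x powr (- c) * x powr (\<rho> + \<nu> - 1) = x powr (a - 1)"
        by (simp add: powr_add[symmetric] a_def algebra_simps)
      then have "of_real (x powr (- c)) * of_real (x powr (\<rho> + \<nu> - 1) * E x) = of_real (x powr (a - 1)) * complex_of_real (E x)"
        by (metis mult.assoc of_real_mult)
      also have "complex_of_real (x powr (a - 1)) = of_real x powr (of_real a - 1)"
        using x powr_of_real[of x "a - 1"] by simp
      finally show ?thesis by (simp add: H_def)
    qed
    ultimately show ?thesis by (simp add: mult.assoc)
  qed
  have inner: "(LINT x:{0<..}|lborel. of_real x powr (- (\<i> * of_real t)) * H x) =
      of_real K * Gamma_prod r (Complex a (- t)) * of_real B powr (- Complex a (- t))" for t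
  proof -
    have "(LINT x:{0<..}|lborel. of_real x powr (- (\<i> * of_real t)) * H x) =
        (LINT x:{0<..}|lborel. of_real x powr (Complex a (- t) - 1) * of_real (E x))"
    proof (rule set_lebesgue_integral_cong)
      show "\<forall>x. x \<in> {0<..} \<longrightarrow> of_real x powr (- (\<i> * of_real t)) * H x = of_real x powr (Complex a (- t) - 1) * of_real (E x)"
        by (auto simp: H_def of_real_powr_eq_exp Complex_eq exp_add[symmetric] algebra_simps)
    qed auto
    also have "\<dots> = of_real K * Gamma_prod r (Complex a (- t)) * of_real B powr (- Complex a (- t))"
      unfolding E_def K_def B_def using r pos a by (intro Mellin_stretched_exponential_Gamma_prod) auto
    finally show ?thesis .
  qed
  have int\<phi>: "integrable lborel \<phi>"
    unfolding \<phi>_def by (rule meijer_G_cdf(1)[OF r pos(3) c])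
  have intH: "set_integrable lborel {0<..} H"
    unfolding H_def E_def using r pos a by (intro Mellin_stretched_exponential) auto
  have "(LINT x:{0<..}|lborel.
      meijer_G r 1 [of_real (1 - \<rho>)] (map of_real (zero_half r @ [- \<rho>])) (of_real (A * x)) *
      of_real (x powr (\<rho> + \<nu> - 1) * E x)) =
     (LINT x:{0<..}|lborel. 1 / (2 * pi) * ((LINT t|lborel. \<phi> t * of_real x powr (- (\<i> * of_real t))) * H x))"
    using G1 by (intro set_lebesgue_integral_cong) auto
  also have "\<dots> = 1 / (2 * pi) * (LINT t|lborel. \<phi> t * (LINT x:{0<..}|lborel. of_real x powr (- (\<i> * of_real t)) * H x))"
    unfolding set_integral_mult_right Mellin_Fubini[OF int\<phi> intH] ..
  also have "(LINT t|lborel. \<phi> t * (LINT x:{0<..}|lborel. of_real x powr (- (\<i> * of_real t)) * H x)) =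
      (LINT t|lborel. \<phi> t * (of_real K * Gamma_prod r (Complex a (- t)) * of_real B powr (- Complex a (- t))))"
    unfolding inner ..
  \<comment> \<open>The reflection maps \<open>Complex c t\<close> to
    \<open>Complex a (- t)\<close>; replacing t by - t lets the new line be traversed
    upwards.\<close>
  also have "\<dots> = (LINT t|lborel. \<phi> (- t) * (of_real K * Gamma_prod r (Complex a t) * of_real B powr (- Complex a t)))"
    by (subst lborel_integral_real_affine[where c = "-1" and t = 0]) auto
  also have "\<dots> = (LINT t|lborel. of_real (K * A powr (- (\<rho> + \<nu>))) *
      (Gamma_prod r (Complex a t) * Gamma_prod r (of_real (\<rho> + \<nu>) - Complex a t) /
             (Complex a t - of_real \<nu>) * of_real (B / A) powr (- Complex a t)))"
  proof (intro Bochner_Integration.integral_cong refl)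
    fix t
    define w where "w = Complex a t"
    have s: "Complex c (- t) = of_real (\<rho> + \<nu>) - w"
      by (simp add: w_def a_def complex_eq_iff)
    \<comment> \<open>The reflection inverts the power of A: this yields the quotient B / A as
      argument and A powr (- (\<rho> + \<nu>)) as prefactor.\<close>
    have pw: "of_real A powr (- (of_real (\<rho> + \<nu>) - w)) * of_real B powr (- w) =
        of_real (A powr (- (\<rho> + \<nu>))) * of_real (B / A) powr (- w)"
    proof -
      have "complex_of_real (A powr (- (\<rho> + \<nu>))) = exp (- of_real (\<rho> + \<nu>) * of_real (ln A))"
        using pos by (simp add: powr_def exp_of_real[symmetric])
      moreover have "B / A > 0" using B pos by simp
      ultimately show ?thesis
        using pos B by (simp add: of_real_powr_eq_exp ln_div exp_add[symmetric] algebra_simps del: of_real_divide)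
    qed
    have "of_real \<rho> - (of_real (\<rho> + \<nu>) - w) = w - of_real \<nu>" by simp
    then have "\<phi> (- t) * (of_real K * Gamma_prod r w * of_real B powr (- w)) =
       of_real K * (Gamma_prod r w * Gamma_prod r (of_real (\<rho> + \<nu>) - w) / (w - of_real \<nu>)) *
       (of_real A powr (- (of_real (\<rho> + \<nu>) - w)) * of_real B powr (- w))"
      unfolding \<phi>_def s by simp
    then show "\<phi> (- t) * (of_real K * Gamma_prod r (Complex a t) * of_real B powr (- Complex a t)) =
        of_real (K * A powr (- (\<rho> + \<nu>))) *
        (Gamma_prod r (Complex a t) * Gamma_prod r (of_real (\<rho> + \<nu>) - Complex a t) /
             (Complex a t - of_real \<nu>) * of_real (B / A) powr (- Complex a t))"
      unfolding pw w_def[symmetric] by (simp add: mult_ac)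
  qed
  also have "1 / (2 * pi) * \<dots> = of_real (K * A powr (- (\<rho> + \<nu>))) *
      meijer_G (r + 1) r (map of_real t5) (map of_real (zero_half r @ [- \<nu>])) (of_real (B / A))"
  proof -
    have "B / A > 0" "0 \<le> \<nu>" using B pos by auto
    from meijer_G_sop[OF r this a(1,2) \<omega> t5] show ?thesis
      unfolding integral_mult_right_zero by (simp only: mult_ac)
  qed
  finally show ?thesis by (simp add: E_def B_def K_def)
qed

section \<open>The closed form for the lower bound\<close>

theorem mainTheorem6:
  fixes P :: "'a measure"
    and M_d M_e \<gamma>_d \<gamma>_e :: "'a \<Rightarrow> real"
    and f_e :: "real \<Rightarrow> real"
    and r N_d N_e :: nat
    and E_d E_e V_d V_e l_d l_e k_d k_e \<mu>_d \<mu>_e \<tau>_s \<Psi> \<omega> SOP_L :: real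
    and t5 :: "real list"
  assumes "prob_space P"
    and "r \<in> {1, 2}"
    and "N_d \<ge> 1" and "N_e \<ge> 1"
    and "M_d \<in> borel_measurable P" and "AE x in P. M_d x > 0"
    and "integrable P M_d" and "integrable P (\<lambda>x. (M_d x)\<^sup>2)"
    and "M_e \<in> borel_measurable P" and "AE x in P. M_e x > 0"
    and "integrable P M_e" and "integrable P (\<lambda>x. (M_e x)\<^sup>2)"
    and "E_d = prob_space.expectation P M_d" and "V_d = prob_space.variance P M_d"
    and "E_e = prob_space.expectation P M_e" and "V_e = prob_space.variance P M_e"
    and "V_d > 0" and "V_e > 0"
    and "l_d = real N_d * E_d\<^sup>2 / V_d" and "k_d = V_d / E_d"
    and "l_e = real N_e * E_e\<^sup>2 / V_e" and "k_e = V_e / E_e"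
    and "\<mu>_d > 0" and "\<mu>_e > 0"
    and "\<gamma>_d \<in> borel_measurable P"
    and "\<And>x. x > 0 \<Longrightarrow>
          complex_of_real (cdf (distr P borel \<gamma>_d) x) = snr_cdf_expr r E_d k_d l_d \<mu>_d x"
    and "distributed P lborel \<gamma>_e (\<lambda>x. ennreal (f_e x))"
    and "\<And>x. x > 0 \<Longrightarrow> complex_of_real (f_e x) = snr_pdf_expr r E_e k_e l_e \<mu>_e x"
    and "\<Psi> = 2 powr \<tau>_s"
    and "\<omega> = 1 - l_d / real r - l_e / real r"
    and "t5 = (if r = 1 then [\<omega>, \<omega> + l_d] else [\<omega>, \<omega> - 1 / 2, \<omega> + l_d / 2])"
    and "SOP_L = (LINT x:{0<..}|lborel. cdf (distr P borel \<gamma>_d) (\<Psi> * x) * f_e x)"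
  shows "complex_of_real SOP_L =
    of_real (Lambda1 E_e k_e l_e * Lambda3 r E_d k_d l_d * \<mu>_d powr (l_e / real r) /
      (real r * \<mu>_e powr (l_e / real r) * \<Psi> powr (l_e / real r)
        * Lambda4 r E_d k_d powr ((l_d + l_e) / real r) * (2 * pi) powr ((real r - 1) / 2))) *
    meijer_G (r + 1) r (map of_real t5) (map of_real (zero_half r @ [- l_e / real r]))
      (of_real (Lambda2 E_e k_e ^ r * \<mu>_d / (real r ^ r * \<Psi> * Lambda4 r E_d k_d * \<mu>_e)))"
proof -
  interpret prob_space P by fact
  have r: "r \<in> {1, 2}" "real r > 0" using assms(2) by auto
  have E: "E_d > 0" "E_e > 0"
    using expectation_greater[OF assms(7,6)] expectation_greater[OF assms(11,10)] assms(13,15) by auto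
  have l: "l_d > 0" "l_e > 0" and k: "k_d > 0" "k_e > 0"
    using E assms by auto
  define \<rho> \<nu> where "\<rho> = l_d / real r" and "\<nu> = l_e / real r"
  have pos: "\<rho> > 0" "\<nu> > 0" using l r by (auto simp: \<rho>_def \<nu>_def)
  define \<Lambda> where "\<Lambda> = Lambda4 r E_d k_d"
  define \<beta> where "\<beta> = Lambda2 E_e k_e"
  \<comment> \<open>The coefficient of x in the argument of the destination G-function, evaluated at
    \<Psi> x.\<close>
  define A where "A = \<Lambda> * \<Psi> / \<mu>_d"
  have pos': "\<Lambda> > 0" "\<beta> > 0" "\<Psi> > 0" "A > 0"
    using E k r assms(23,29) by (auto simp: \<Lambda>_def \<beta>_def A_def Lambda4_def Lambda2_def)
  define C_d where "C_d = Lambda3 r E_d k_d l_d / (sqrt (real r) * \<mu>_d powr \<rho>) * \<Psi> powr \<rho>"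
  define C_e where "C_e = Lambda1 E_e k_e l_e / (real r * \<mu>_e powr \<nu>)"
  define G where "G = (\<lambda>x. meijer_G r 1 [of_real (1 - \<rho>)] (map of_real (zero_half r @ [- \<rho>])) (of_real (A * x)))"
  define h where "h = (\<lambda>x. x powr (\<rho> + \<nu> - 1) * exp (- (\<beta> * (x / \<mu>_e) powr (1 / real r))))"
  have cdf: "complex_of_real (cdf (distr P borel \<gamma>_d) (\<Psi> * x)) = of_real (C_d * x powr \<rho>) * G x" if "x > 0" for x
  proof -
    have "\<Psi> * x > 0" using that pos' by simp
    from assms(26)[OF this] show ?thesis
      using that pos' by (simp add: snr_cdf_expr_def \<rho>_def[symmetric] \<Lambda>_def[symmetric] C_d_def G_def A_def powr_mult mult_ac)
  qed
  have pdf: "complex_of_real (f_e x) = of_real (C_e * x powr (\<nu> - 1) * exp (- (\<beta> * (x / \<mu>_e) powr (1 / real r))))" if "x > 0" for x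
  proof -
    have "\<beta> * (x / \<mu>_e) powr (1 / real r) > 0" using that pos' assms(24) by simp
    from assms(28)[OF that] meijer_G_1_0_0_1[OF this] show ?thesis
      by (simp add: snr_pdf_expr_def \<nu>_def[symmetric] \<beta>_def[symmetric] C_e_def)
  qed
  have "complex_of_real SOP_L = (LINT x:{0<..}|lborel. complex_of_real (cdf (distr P borel \<gamma>_d) (\<Psi> * x)) * complex_of_real (f_e x))"
    unfolding assms(32) set_lebesgue_integral_def
    by (subst integral_complex_of_real[symmetric]) (simp add: scaleR_conv_of_real)
  also have "\<dots> = (LINT x:{0<..}|lborel. of_real (C_d * C_e) * (G x * of_real (h x)))"
  proof (rule set_lebesgue_integral_cong)
    show "\<forall>x. x \<in> {0<..} \<longrightarrow> complex_of_real (cdf (distr P borel \<gamma>_d) (\<Psi> * x)) * complex_of_real (f_e x) =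
        of_real (C_d * C_e) * (G x * of_real (h x))"
    proof (intro allI impI)
      fix x :: real assume "x \<in> {0<..}"
      then have x: "x > 0" by simp
      have "x powr \<rho> * x powr (\<nu> - 1) = x powr (\<rho> + \<nu> - 1)"
        by (simp add: powr_add[symmetric] algebra_simps)
      then have h: "h x = x powr \<rho> * x powr (\<nu> - 1) * exp (- (\<beta> * (x / \<mu>_e) powr (1 / real r)))"
        by (simp add: h_def)
      show "complex_of_real (cdf (distr P borel \<gamma>_d) (\<Psi> * x)) * complex_of_real (f_e x) =
        of_real (C_d * C_e) * (G x * of_real (h x))"
        unfolding cdf[OF x] pdf[OF x] h by (simp only: of_real_mult mult_ac)
    qed
  qed auto
  also have "\<dots> = of_real (C_d * C_e) * (LINT x:{0<..}|lborel. G x * of_real (h x))"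
    by (rule set_integral_mult_right)
  also have "(LINT x:{0<..}|lborel. G x * of_real (h x)) =
    of_real (sqrt (real r) * (2 * pi) powr (- ((real r - 1) / 2)) * A powr (- (\<rho> + \<nu>))) *
    meijer_G (r + 1) r (map of_real t5) (map of_real (zero_half r @ [- \<nu>]))
      (of_real (\<beta> ^ r / (real r ^ r * \<mu>_e) / A))"
    \<comment> \<open>The two forms of \<open>t5\<close> agree: \<rho> is l_d for r = 1 and l_d / 2
      for r = 2.\<close>
    unfolding G_def h_def using r assms(24,30,31) pos pos'
    by (intro integral_meijer_G_stretched_exponential) (auto simp: \<rho>_def \<nu>_def)
  also have "\<beta> ^ r / (real r ^ r * \<mu>_e) / A = \<beta> ^ r * \<mu>_d / (real r ^ r * \<Psi> * \<Lambda> * \<mu>_e)"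
    by (simp add: A_def mult_ac)
  also have "of_real (C_d * C_e) * (of_real (sqrt (real r) * (2 * pi) powr (- ((real r - 1) / 2)) * A powr (- (\<rho> + \<nu>))) * M) =
      of_real (Lambda1 E_e k_e l_e * Lambda3 r E_d k_d l_d * \<mu>_d powr \<nu> /
      (real r * \<mu>_e powr \<nu> * \<Psi> powr \<nu> * \<Lambda> powr (\<rho> + \<nu>) * (2 * pi) powr ((real r - 1) / 2))) * M" for M
  proof -
    \<comment> \<open>The powers of \<open>\<mu>_d\<close> and \<Psi> with exponent \<rho> cancel
      against those in \<open>C_d\<close>, and \<open>sqrt r\<close> against that of the Mellin
      transform; the exponent \<nu> remains. The visible power of 2 pi stems from the multiplication
      formula and is a second one beside that inside \<open>Lambda3\<close>.\<close>
    have "A powr (- (\<rho> + \<nu>)) = \<mu>_d powr (\<rho> + \<nu>) / (\<Lambda> powr (\<rho> + \<nu>) * \<Psi> powr (\<rho> + \<nu>))"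
      using pos' assms(23) unfolding A_def powr_minus by (simp add: powr_divide powr_mult)
    then have "C_d * C_e * (sqrt (real r) * (2 * pi) powr (- ((real r - 1) / 2)) * A powr (- (\<rho> + \<nu>))) =
      Lambda1 E_e k_e l_e * Lambda3 r E_d k_d l_d * \<mu>_d powr \<nu> /
      (real r * \<mu>_e powr \<nu> * \<Psi> powr \<nu> * \<Lambda> powr (\<rho> + \<nu>) * (2 * pi) powr ((real r - 1) / 2))"
      using r(2) pos' assms(23,24) unfolding C_d_def C_e_def powr_minus[of "2 * pi"]
      by (simp add: powr_add[of \<mu>_d] powr_add[of \<Psi>] divide_simps) (simp add: mult_ac)
    then show ?thesis by (metis mult.assoc of_real_mult)
  qed
  finally show ?thesis
    by (simp add: \<rho>_def \<nu>_def \<Lambda>_def \<beta>_def add_divide_distrib)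
qed

end
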